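(* Let $1<p<\infty$, let $\mathbb M$ be a Riemannian manifold of dimension $n$, let $\varepsilon>0$, $h\in C^\infty([0,\infty))$, and let $v$ be a smooth solution on $\mathbb M\times(0,T]$ of $$v_t=L_\varepsilon v+h(|\nabla v|^2).$$ For $\alpha\in\mathbb R$ define, with $s=|\nabla v|^2$, $$w_\alpha:=h(s)-\alpha\,v_t.$$ Then, at every point of $\mathbb M\times(0,T]$, $$L_\varepsilon w_\alpha-(w_\alpha)_t=2h'(s)\big[\mathcal Q_\varepsilon+\operatorname{Ric}(\nabla v,\nabla v)\big]+h''(s)\,a^{ij}_\varepsilon\,s_is_j-2\langle\nabla w_\alpha,A_\varepsilon\rangle,$$ where $\mathcal Q_\varepsilon$ and $A_\varepsilon$ are independent of $\alpha$ and given by $$\mathcal Q_\varepsilon=|\nabla^2v|^2+(p-2)\frac{|\nabla^2v(\nabla v)|^2}{\sigma},\qquad A_\varepsilon=h'(s)\nabla v+(p-2)B_\varepsilon,\qquad B_\varepsilon=\frac{\nabla^2v(\nabla v)}{\sigma}-\frac{\nabla^2v(\nabla v,\nabla v)}{\sigma^2}\nabla v,$$ with $\sigma=s+\varepsilon^2$.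
   Context: The metric $g$ is independent of time. Notation: $a^{ij}_\varepsilon=g^{ij}+(p-2)\frac{\nabla^iv\,\nabla^jv}{\sigma}$ and $L_\varepsilon\phi=a^{ij}_\varepsilon\nabla_{ij}\phi$, where $\nabla_{ij}\phi$ are the components of the Hessian $\nabla^2\phi$; $s_i=\nabla_is$; $\nabla^2v(\nabla v)$ denotes the vector obtained by applying the Hessian, as an endomorphism, to $\nabla v$; repeated indices are summed, and $|\nabla^2v|$ is the Hilbert-Schmidt norm. *)

theory Defs
  imports "HOL-Analysis.Analysis"
begin

section \<open>Smooth functions\<close>

text \<open>
  The sets \<open>S\<close> of interest are open sets \<open>U\<close> of \<open>\<real>\<^sup>n\<close>, the half-line \<open>[0,\<infinity>)\<close>
  and \<open>U \<times> (0,T]\<close>. On these the derivative within \<open>S\<close> is unique; at the boundary points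
  \<open>0\<close> and \<open>t = T\<close> it is the one-sided derivative.
\<close>

primrec Ck_on :: "nat \<Rightarrow> 'a::real_normed_vector set \<Rightarrow> ('a \<Rightarrow> 'b::real_normed_vector) \<Rightarrow> bool" where
  "Ck_on 0 S f \<longleftrightarrow> continuous_on S f"
| "Ck_on (Suc k) S f \<longleftrightarrow>
     (\<exists>f'. (\<forall>x\<in>S. (f has_derivative f' x) (at x within S)) \<and> (\<forall>u. Ck_on k S (\<lambda>x. f' x u)))"

definition smooth_on :: "'a::real_normed_vector set \<Rightarrow> ('a \<Rightarrow> 'b::real_normed_vector) \<Rightarrow> bool" where
  "smooth_on S f \<longleftrightarrow> (\<forall>k. Ck_on k S f)"

definition deriv_within :: "real set \<Rightarrow> (real \<Rightarrow> real) \<Rightarrow> real \<Rightarrow> real" where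
  "deriv_within S f r = vector_derivative f (at r within S)"


section \<open>Riemannian manifolds\<close>

text \<open>
  A chart is a domain together with a coordinate map; the dimension is \<open>n = CARD('n)\<close>.
\<close>

type_synonym ('a, 'n) chart = "'a set \<times> ('a \<Rightarrow> real ^ 'n)"

abbreviation cdom :: "('a, 'n::finite) chart \<Rightarrow> 'a set" where
  "cdom c \<equiv> fst c"

abbreviation cmap :: "('a, 'n::finite) chart \<Rightarrow> 'a \<Rightarrow> real ^ 'n" where
  "cmap c \<equiv> snd c"

definition cinv :: "('a, 'n::finite) chart \<Rightarrow> real ^ 'n \<Rightarrow> 'a" where
  "cinv c = inv_into (cdom c) (cmap c)"

definition smooth_manifold :: "'a topology \<Rightarrow> ('a, 'n::finite) chart set \<Rightarrow> bool" where
  "smooth_manifold M \<A> \<longleftrightarrow>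
     Hausdorff_space M \<and> second_countable M \<and>
     (\<Union>c\<in>\<A>. cdom c) = topspace M \<and>
     (\<forall>c\<in>\<A>. openin M (cdom c) \<and> open (cmap c ` cdom c) \<and>
        homeomorphic_map (subtopology M (cdom c)) (top_of_set (cmap c ` cdom c)) (cmap c)) \<and>
     (\<forall>c\<in>\<A>. \<forall>d\<in>\<A>. smooth_on (cmap c ` (cdom c \<inter> cdom d)) (cmap d \<circ> cinv c))"

text \<open>The coordinate derivative \<open>\<partial>\<^sub>i f\<close> at a point \<open>x\<close> of the domain of the chart \<open>c\<close>.\<close>

definition pd :: "('a, 'n::finite) chart \<Rightarrow> 'n \<Rightarrow> ('a \<Rightarrow> real) \<Rightarrow> 'a \<Rightarrow> real" where
  "pd c i f x = deriv (\<lambda>r. f (cinv c (cmap c x + r *\<^sub>R axis i 1))) 0"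

text \<open>
  Tensor fields are given classically, by their components in every chart of the atlas. So the
  metric is a function of a chart and a point; \<open>g c x $ i $ j\<close> is \<open>g\<^sub>i\<^sub>j(x)\<close> in the chart \<open>c\<close>.
  The last condition below is the transformation law of a covariant 2-tensor.
\<close>

type_synonym ('a, 'n) metric = "('a, 'n) chart \<Rightarrow> 'a \<Rightarrow> real ^ 'n ^ 'n"

definition riemannian_metric :: "('a, 'n::finite) chart set \<Rightarrow> ('a, 'n) metric \<Rightarrow> bool" where
  "riemannian_metric \<A> g \<longleftrightarrow>
     (\<forall>c\<in>\<A>. smooth_on (cmap c ` cdom c) (g c \<circ> cinv c)) \<and>
     (\<forall>c\<in>\<A>. \<forall>x\<in>cdom c. transpose (g c x) = g c x \<and> (\<forall>u. u \<noteq> 0 \<longrightarrow> u \<bullet> (g c x *v u) > 0)) \<and>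
     (\<forall>c\<in>\<A>. \<forall>d\<in>\<A>. \<forall>x\<in>cdom c \<inter> cdom d. \<forall>i j.
        g c x $ i $ j =
          (\<Sum>k\<in>UNIV. \<Sum>l\<in>UNIV.
             pd c i (\<lambda>y. cmap d y $ k) x * pd c j (\<lambda>y. cmap d y $ l) x * g d x $ k $ l))"

definition riemannian_manifold ::
    "'a topology \<Rightarrow> ('a, 'n::finite) chart set \<Rightarrow> ('a, 'n) metric \<Rightarrow> bool" where
  "riemannian_manifold M \<A> g \<longleftrightarrow> smooth_manifold M \<A> \<and> riemannian_metric \<A> g"

text \<open>
  All operators below are computed in a chart \<open>c\<close> around the point \<open>x\<close>. Vectors and tensors are
  returned as their components in \<open>c\<close>; the scalars obtained by full contraction do not depend
  on the chart.
\<close>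

definition g_inv :: "('a, 'n::finite) metric \<Rightarrow> ('a, 'n) chart \<Rightarrow> 'a \<Rightarrow> real ^ 'n ^ 'n" where
  "g_inv g c x = matrix_inv (g c x)"

definition g_inner ::
    "('a, 'n::finite) metric \<Rightarrow> ('a, 'n) chart \<Rightarrow> 'a \<Rightarrow> real ^ 'n \<Rightarrow> real ^ 'n \<Rightarrow> real" where
  "g_inner g c x X Y = (\<Sum>i\<in>UNIV. \<Sum>j\<in>UNIV. g c x $ i $ j * X $ i * Y $ j)"

definition grad ::
    "('a, 'n::finite) metric \<Rightarrow> ('a, 'n) chart \<Rightarrow> ('a \<Rightarrow> real) \<Rightarrow> 'a \<Rightarrow> real ^ 'n" where
  "grad g c f x = (\<chi> i. \<Sum>j\<in>UNIV. g_inv g c x $ i $ j * pd c j f x)"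

text \<open>\<open>christoffel g c k i j\<close> is \<open>\<Gamma>\<^sup>k\<^sub>i\<^sub>j\<close> of the Levi-Civita connection.\<close>

definition christoffel ::
    "('a, 'n::finite) metric \<Rightarrow> ('a, 'n) chart \<Rightarrow> 'n \<Rightarrow> 'n \<Rightarrow> 'n \<Rightarrow> 'a \<Rightarrow> real" where
  "christoffel g c k i j x =
     (1/2) * (\<Sum>l\<in>UNIV. g_inv g c x $ k $ l *
       (pd c i (\<lambda>y. g c y $ j $ l) x + pd c j (\<lambda>y. g c y $ i $ l) x
        - pd c l (\<lambda>y. g c y $ i $ j) x))"

text \<open>
  \<open>riemann g c l k i j\<close> is the coefficient of \<open>\<partial>\<^sub>l\<close> in \<open>R(\<partial>\<^sub>i,\<partial>\<^sub>j)\<partial>\<^sub>k\<close>, where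
  \<open>R(X,Y)Z = \<nabla>\<^sub>X\<nabla>\<^sub>YZ - \<nabla>\<^sub>Y\<nabla>\<^sub>XZ - \<nabla>\<^bsub>[X,Y]\<^esub>Z\<close>; and \<open>Ric(Y,Z)\<close> is the trace of \<open>X \<mapsto> R(X,Y)Z\<close>,
  so that round spheres have positive Ricci curvature.
\<close>

definition riemann ::
    "('a, 'n::finite) metric \<Rightarrow> ('a, 'n) chart \<Rightarrow> 'n \<Rightarrow> 'n \<Rightarrow> 'n \<Rightarrow> 'n \<Rightarrow> 'a \<Rightarrow> real" where
  "riemann g c l k i j x =
     pd c i (christoffel g c l j k) x - pd c j (christoffel g c l i k) x
     + (\<Sum>m\<in>UNIV. christoffel g c l i m x * christoffel g c m j k x
                - christoffel g c l j m x * christoffel g c m i k x)"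

definition Ric ::
    "('a, 'n::finite) metric \<Rightarrow> ('a, 'n) chart \<Rightarrow> 'a \<Rightarrow> real ^ 'n \<Rightarrow> real ^ 'n \<Rightarrow> real" where
  "Ric g c x Y Z = (\<Sum>j\<in>UNIV. \<Sum>k\<in>UNIV. (\<Sum>i\<in>UNIV. riemann g c i k i j x) * Y $ j * Z $ k)"

text \<open>\<open>hess g c f x $ i $ j\<close> is \<open>\<nabla>\<^sub>i\<^sub>jf\<close>.\<close>

definition hess ::
    "('a, 'n::finite) metric \<Rightarrow> ('a, 'n) chart \<Rightarrow> ('a \<Rightarrow> real) \<Rightarrow> 'a \<Rightarrow> real ^ 'n ^ 'n" where
  "hess g c f x =
     (\<chi> i j. pd c i (pd c j f) x - (\<Sum>k\<in>UNIV. christoffel g c k i j x * pd c k f x))"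

definition hess_endo ::
    "('a, 'n::finite) metric \<Rightarrow> ('a, 'n) chart \<Rightarrow> ('a \<Rightarrow> real) \<Rightarrow> 'a \<Rightarrow> real ^ 'n \<Rightarrow> real ^ 'n" where
  "hess_endo g c f x X =
     (\<chi> i. \<Sum>j\<in>UNIV. \<Sum>k\<in>UNIV. g_inv g c x $ i $ j * hess g c f x $ j $ k * X $ k)"

definition hess_form ::
    "('a, 'n::finite) metric \<Rightarrow> ('a, 'n) chart \<Rightarrow> ('a \<Rightarrow> real) \<Rightarrow> 'a \<Rightarrow>
       real ^ 'n \<Rightarrow> real ^ 'n \<Rightarrow> real" where
  "hess_form g c f x X Y = (\<Sum>i\<in>UNIV. \<Sum>j\<in>UNIV. hess g c f x $ i $ j * X $ i * Y $ j)"

definition hess_HS_sq ::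
    "('a, 'n::finite) metric \<Rightarrow> ('a, 'n) chart \<Rightarrow> ('a \<Rightarrow> real) \<Rightarrow> 'a \<Rightarrow> real" where
  "hess_HS_sq g c f x =
     (\<Sum>i\<in>UNIV. \<Sum>j\<in>UNIV. \<Sum>k\<in>UNIV. \<Sum>l\<in>UNIV.
        g_inv g c x $ i $ k * g_inv g c x $ j $ l * hess g c f x $ i $ j * hess g c f x $ k $ l)"


section \<open>Smooth functions on \<open>M \<times> (0,T]\<close>\<close>

text \<open>A time-dependent function is written \<open>v t x\<close>, with the time as its first argument.\<close>

definition smooth_spacetime ::
    "('a, 'n::finite) chart set \<Rightarrow> real \<Rightarrow> (real \<Rightarrow> 'a \<Rightarrow> real) \<Rightarrow> bool" where
  "smooth_spacetime \<A> T v \<longleftrightarrow>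
     (\<forall>c\<in>\<A>. smooth_on (cmap c ` cdom c \<times> {0<..T}) (\<lambda>(y, t). v t (cinv c y)))"

definition dt :: "real \<Rightarrow> (real \<Rightarrow> 'a \<Rightarrow> real) \<Rightarrow> real \<Rightarrow> 'a \<Rightarrow> real" where
  "dt T v t x = deriv_within {0<..T} (\<lambda>\<tau>. v \<tau> x) t"


section \<open>The regularised equation\<close>

text \<open>In this section \<open>u\<close> is the function \<open>v(\<cdot>,t)\<close> on the manifold.\<close>

definition grad_sq ::
    "('a, 'n::finite) metric \<Rightarrow> ('a, 'n) chart \<Rightarrow> ('a \<Rightarrow> real) \<Rightarrow> 'a \<Rightarrow> real" where
  "grad_sq g c u x = g_inner g c x (grad g c u x) (grad g c u x)"

definition sigma ::
    "('a, 'n::finite) metric \<Rightarrow> real \<Rightarrow> ('a, 'n) chart \<Rightarrow> ('a \<Rightarrow> real) \<Rightarrow> 'a \<Rightarrow> real" where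
  "sigma g \<epsilon> c u x = grad_sq g c u x + \<epsilon>\<^sup>2"

definition a_eps ::
    "('a, 'n::finite) metric \<Rightarrow> real \<Rightarrow> real \<Rightarrow> ('a, 'n) chart \<Rightarrow> ('a \<Rightarrow> real) \<Rightarrow> 'a \<Rightarrow>
       real ^ 'n ^ 'n" where
  "a_eps g p \<epsilon> c u x =
     (\<chi> i j. g_inv g c x $ i $ j
            + (p - 2) * (grad g c u x $ i * grad g c u x $ j / sigma g \<epsilon> c u x))"

text \<open>\<open>L_eps g p \<epsilon> c u\<close> is the operator whose coefficients come from \<open>u\<close>.\<close>

definition L_eps ::
    "('a, 'n::finite) metric \<Rightarrow> real \<Rightarrow> real \<Rightarrow> ('a, 'n) chart \<Rightarrow> ('a \<Rightarrow> real) \<Rightarrow>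
       ('a \<Rightarrow> real) \<Rightarrow> 'a \<Rightarrow> real" where
  "L_eps g p \<epsilon> c u \<phi> x =
     (\<Sum>i\<in>UNIV. \<Sum>j\<in>UNIV. a_eps g p \<epsilon> c u x $ i $ j * hess g c \<phi> x $ i $ j)"

definition Q_eps ::
    "('a, 'n::finite) metric \<Rightarrow> real \<Rightarrow> real \<Rightarrow> ('a, 'n) chart \<Rightarrow> ('a \<Rightarrow> real) \<Rightarrow> 'a \<Rightarrow> real" where
  "Q_eps g p \<epsilon> c u x =
     (let H = hess_endo g c u x (grad g c u x)
      in hess_HS_sq g c u x + (p - 2) * (g_inner g c x H H / sigma g \<epsilon> c u x))"

definition B_eps ::
    "('a, 'n::finite) metric \<Rightarrow> real \<Rightarrow> ('a, 'n) chart \<Rightarrow> ('a \<Rightarrow> real) \<Rightarrow> 'a \<Rightarrow> real ^ 'n" where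
  "B_eps g \<epsilon> c u x =
     (1 / sigma g \<epsilon> c u x) *\<^sub>R hess_endo g c u x (grad g c u x)
     - (hess_form g c u x (grad g c u x) (grad g c u x) / (sigma g \<epsilon> c u x)\<^sup>2) *\<^sub>R grad g c u x"

definition A_eps ::
    "('a, 'n::finite) metric \<Rightarrow> real \<Rightarrow> real \<Rightarrow> (real \<Rightarrow> real) \<Rightarrow> ('a, 'n) chart \<Rightarrow>
       ('a \<Rightarrow> real) \<Rightarrow> 'a \<Rightarrow> real ^ 'n" where
  "A_eps g p \<epsilon> h c u x =
     deriv_within {0..} h (grad_sq g c u x) *\<^sub>R grad g c u x + (p - 2) *\<^sub>R B_eps g \<epsilon> c u x"

definition smooth_solution ::
    "('a, 'n::finite) chart set \<Rightarrow> ('a, 'n) metric \<Rightarrow> real \<Rightarrow> real \<Rightarrow> (real \<Rightarrow> real) \<Rightarrow> real \<Rightarrow>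
       (real \<Rightarrow> 'a \<Rightarrow> real) \<Rightarrow> bool" where
  "smooth_solution \<A> g p \<epsilon> h T v \<longleftrightarrow>
     smooth_spacetime \<A> T v \<and>
     (\<forall>c\<in>\<A>. \<forall>x\<in>cdom c. \<forall>t\<in>{0<..T}.
        dt T v t x = L_eps g p \<epsilon> c (v t) (v t) x + h (grad_sq g c (v t) x))"

definition w_alpha ::
    "('a, 'n::finite) metric \<Rightarrow> (real \<Rightarrow> real) \<Rightarrow> real \<Rightarrow> real \<Rightarrow> ('a, 'n) chart \<Rightarrow>
       (real \<Rightarrow> 'a \<Rightarrow> real) \<Rightarrow> real \<Rightarrow> 'a \<Rightarrow> real" where
  "w_alpha g h T \<alpha> c v t x = h (grad_sq g c (v t) x) - \<alpha> * dt T v t x"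

end

theory Submission
  imports Defs
begin

text \<open>
  Write \<open>a : M\<close> for the contraction \<open>a\<^sup>i\<^sup>j M\<^sub>i\<^sub>j\<close>, and \<open>A\<close> for the vector field of the statement. The
  heart of the proof is the equation differentiated in an arbitrary spacetime direction \<open>e\<close>
  (\<open>D_vt\<close>):

    \<open>D\<^sub>e v\<^sub>t = a : \<nabla>\<^sub>e \<nabla>\<^sup>2v + 2 \<langle>\<nabla>\<^sub>e dv, A\<rangle>\<close>.

  Here \<open>A\<close> collects the derivatives of the coefficients \<open>a\<^sup>i\<^sup>j\<close> and of \<open>h(s)\<close>, both of which depend on
  the point only through the metric and \<open>dv\<close>. The formula is used twice. For \<open>e = \<partial>\<^sub>t\<close> it says that
  \<open>v\<^sub>t\<close> solves the linearised equation, \<open>L v\<^sub>t - v\<^sub>t\<^sub>t = -2\<langle>\<nabla>v\<^sub>t, A\<rangle>\<close> (\<open>vt_evolution\<close>). For \<open>e = \<nabla>v\<close> its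
  left-hand side is \<open>s\<^sub>t/2\<close> and \<open>\<nabla>\<^sub>e dv\<close> is \<open>ds/2\<close>, so that

    \<open>s\<^sub>t = 2 a : \<nabla>\<^bsub>\<nabla>v\<^esub>\<nabla>\<^sup>2v + 2 \<langle>\<nabla>s, A\<rangle>\<close>  (\<open>vt_along_gradient\<close>).

  On the other hand the Hessian of \<open>s\<close> is twice the sum of \<open>\<nabla>\<^sup>2v \<circ> \<nabla>\<^sup>2v\<close>, whose contraction with \<open>a\<close> is
  \<open>\<Q>\<close>, and of the third derivatives \<open>\<nabla>\<^sub>i\<nabla>\<^sub>j\<nabla>\<^sub>k v \<nabla>\<^sup>k v\<close>. The Ricci identity and the skewness of the
  curvature turn the contraction of the latter into \<open>a : \<nabla>\<^bsub>\<nabla>v\<^esub>\<nabla>\<^sup>2v + Ric(\<nabla>v,\<nabla>v)\<close>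
  (\<open>a_trace_hess_s_third\<close>). Subtracting gives \<open>L s - s\<^sub>t = 2(\<Q> + Ric(\<nabla>v,\<nabla>v)) - 2\<langle>\<nabla>s, A\<rangle>\<close>. The theorem
  follows by the chain rule for \<open>h(s)\<close> and linearity (\<open>evolution_of_w\<close>).

  The computation is done in the given chart, without normal coordinates. Tensors are matrix-valued
  functions of \<open>(y,t)\<close> and the Levi-Civita connection is a matrix \<open>\<Gamma>\<^sub>e\<close> depending linearly on a
  spacetime direction \<open>e\<close>, with \<open>\<Gamma> = 0\<close> on \<open>\<partial>\<^sub>t\<close>. Index manipulations then become matrix algebra,
  and space and time derivatives obey the same rules. The analytic input is that partial derivatives
  commute, also at the final time \<open>T\<close>, where the time derivative is one-sided
  (\<open>dird_commute_parabolic\<close>).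
\<close>

section \<open>Directional derivatives on sets with boundary\<close>

text \<open>
  Every point of the set can be approached within the set along each coordinate axis. This is
  what makes a derivative within the set unique; it allows one-sided boundary points such as the
  endpoint of a half-line and the final time of a parabolic cylinder.
\<close>

definition thick :: "'a::euclidean_space set \<Rightarrow> bool" where
  "thick S \<longleftrightarrow> (\<forall>z\<in>S. \<forall>i\<in>Basis. \<forall>e>0. \<exists>d. 0 < \<bar>d\<bar> \<and> \<bar>d\<bar> < e \<and> z + d *\<^sub>R i \<in> S)"

text \<open>
  The derivative is taken within \<open>S\<close>, so at a boundary point it is the one-sided one, extended
  linearly to the directions that leave \<open>S\<close>.
\<close>

definition dird :: "'a::euclidean_space set \<Rightarrow> 'a \<Rightarrow> ('a \<Rightarrow> 'b::real_normed_vector) \<Rightarrow> 'a \<Rightarrow> 'b" where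
  "dird S e F z = frechet_derivative F (at z within S) e"

lemma thick_half_line: "thick {0::real..}"
  unfolding thick_def
proof (intro ballI allI impI)
  fix z i e :: real assume "z \<in> {0..}" "i \<in> Basis" "0 < e"
  then show "\<exists>d. 0 < \<bar>d\<bar> \<and> \<bar>d\<bar> < e \<and> z + d *\<^sub>R i \<in> {0..}"
    by (intro exI[of _ "e/2"]) auto
qed

lemma thick_Ioc: "thick {0<..T::real}"
  unfolding thick_def
proof (intro ballI allI impI)
  fix z i e :: real assume "z \<in> {0<..T}" "i \<in> Basis" "0 < e"
  then show "\<exists>d. 0 < \<bar>d\<bar> \<and> \<bar>d\<bar> < e \<and> z + d *\<^sub>R i \<in> {0<..T}"
    \<comment> \<open>The step is negative because \<open>z\<close> may be \<open>T\<close>.\<close>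
    by (intro exI[of _ "- min e z / 2"]) (auto simp: min_def)
qed

lemma thick_open_times_interval:
  fixes W :: "(real ^ 'n) set"
  assumes "open W" "0 < (T::real)"
  shows "thick (W \<times> {0<..T})"
  unfolding thick_def
proof (intro ballI allI impI)
  fix z i :: "(real ^ 'n) \<times> real" and e :: real
  assume z: "z \<in> W \<times> {0<..T}" and i: "i \<in> Basis" and e: "0 < e"
  show "\<exists>d. 0 < \<bar>d\<bar> \<and> \<bar>d\<bar> < e \<and> z + d *\<^sub>R i \<in> W \<times> {0<..T}"
  proof (cases "snd i = 0")
    case True
    obtain r where r: "r > 0" "ball (fst z) r \<subseteq> W"
      using assms(1) z by (auto simp: open_contains_ball)
    have "norm i = 1" using i by simp
    moreover have "i = (fst i, 0)" using True by (simp add: prod_eq_iff)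
    ultimately have "norm (fst i, 0::real) = 1" by simp
    then have n: "norm (fst i) = 1" by (simp add: norm_Pair)
    define d where "d = min e r / 2"
    have "fst z + d *\<^sub>R fst i \<in> ball (fst z) r"
      using n r e by (simp add: dist_norm d_def min_def)
    with r have "fst z + d *\<^sub>R fst i \<in> W" by blast
    with z True r e show ?thesis
      by (intro exI[of _ d]) (auto simp: d_def mem_Times_iff min_def)
  next
    case False
    then have i': "i = (0, 1)" using i by (auto simp: Basis_prod_def)
    have t: "0 < snd z" "snd z \<le> T" "fst z \<in> W" using z by auto
    \<comment> \<open>Only steps into the past stay in \<open>(0,T]\<close> when the time is \<open>T\<close>.\<close>
    define d where "d = - min e (snd z) / 2"
    show ?thesis using t e
      by (intro exI[of _ d]) (auto simp: d_def i' mem_Times_iff min_def)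
  qed
qed

lemma dird_eq:
  assumes "thick S" "z \<in> S" "(F has_derivative F') (at z within S)"
  shows "dird S e F z = F' e"
proof -
  have "frechet_derivative F (at z within S) = F'"
  proof (rule frechet_derivative_unique_within[OF _ assms(3)])
    show "(F has_derivative frechet_derivative F (at z within S)) (at z within S)"
      using assms(3) differentiable_def frechet_derivative_works by blast
  qed (use assms in \<open>auto simp: thick_def\<close>)
  then show ?thesis by (simp add: dird_def)
qed

lemma dird_works:
  "F differentiable (at z within S) \<Longrightarrow> (F has_derivative (\<lambda>e. dird S e F z)) (at z within S)"
  by (simp add: dird_def frechet_derivative_works)

lemma linear_dird:
  "F differentiable (at z within S) \<Longrightarrow> linear (\<lambda>e. dird S e F z)"
  by (rule has_derivative_linear[OF dird_works])

lemma dird_cong: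
  assumes "\<And>y. y \<in> S \<Longrightarrow> F y = G y" "z \<in> S"
  shows "dird S e F z = dird S e G z"
proof -
  have "(F has_derivative D) (at z within S) \<longleftrightarrow> (G has_derivative D) (at z within S)" for D
    using assms by (metis has_derivative_transform)
  then show ?thesis by (simp add: dird_def frechet_derivative_def)
qed

lemma differentiable_bounded_linear:
  "bounded_linear L \<Longrightarrow> F differentiable (at z within S) \<Longrightarrow> (\<lambda>y. L (F y)) differentiable (at z within S)"
  unfolding differentiable_def using bounded_linear.has_derivative by blast

lemma differentiable_bounded_bilinear:
  assumes "bounded_bilinear P" "F differentiable (at z within S)" "G differentiable (at z within S)"
  shows "(\<lambda>y. P (F y) (G y)) differentiable (at z within S)"
  using assms(2,3) bounded_bilinear.FDERIV[OF assms(1)] unfolding differentiable_def by blast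

lemma has_derivative_vec:
  fixes F :: "'a::real_normed_vector \<Rightarrow> 'b::euclidean_space ^ 'n"
  assumes "\<And>i. ((\<lambda>z. F z $ i) has_derivative F' i) (at z within S)"
  shows "(F has_derivative (\<lambda>h. \<chi> i. F' i h)) (at z within S)"
proof -
  have bl: "bounded_linear (axis i :: 'b \<Rightarrow> 'b ^ 'n)" for i
    by (intro linear_conv_bounded_linear[THEN iffD1] linearI) (auto simp: axis_def vec_eq_iff)
  have "((\<lambda>z. \<Sum>i\<in>UNIV. axis i (F z $ i) :: 'b ^ 'n) has_derivative (\<lambda>h. \<Sum>i\<in>UNIV. axis i (F' i h))) (at z within S)"
    by (intro has_derivative_sum bounded_linear.has_derivative[OF bl] assms)
  moreover have "(\<Sum>i\<in>UNIV. axis i (f i)) = vec_lambda f" for f :: "'n \<Rightarrow> 'b"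
    by (simp add: vec_eq_iff axis_def)
  ultimately show ?thesis by (simp add: vec_lambda_eta)
qed

lemma differentiable_vec:
  fixes F :: "'a::real_normed_vector \<Rightarrow> 'b::euclidean_space ^ 'n"
  assumes "\<And>i. (\<lambda>z. F z $ i) differentiable (at z within S)"
  shows "F differentiable (at z within S)"
  using has_derivative_vec[of F _ z S] assms unfolding differentiable_def by metis

lemma dird_bounded_linear:
  assumes "thick S" "z \<in> S" "bounded_linear L" "F differentiable (at z within S)"
  shows "dird S e (\<lambda>y. L (F y)) z = L (dird S e F z)"
  by (rule dird_eq[OF assms(1,2) bounded_linear.has_derivative[OF assms(3) dird_works[OF assms(4)]]])

lemma dird_bounded_bilinear:
  assumes "thick S" "z \<in> S" "bounded_bilinear P"
    "F differentiable (at z within S)" "G differentiable (at z within S)"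
  shows "dird S e (\<lambda>y. P (F y) (G y)) z = P (F z) (dird S e G z) + P (dird S e F z) (G z)"
  by (rule dird_eq[OF assms(1,2) bounded_bilinear.FDERIV
        [OF assms(3) dird_works[OF assms(4)] dird_works[OF assms(5)]]])

lemma dird_const:
  "thick S \<Longrightarrow> z \<in> S \<Longrightarrow> dird S e (\<lambda>y. k) z = 0"
  by (rule dird_eq[where F' = "\<lambda>_. 0"]) auto

lemma dird_add:
  assumes "thick S" "z \<in> S" "F differentiable (at z within S)" "G differentiable (at z within S)"
  shows "dird S e (\<lambda>y. F y + G y) z = dird S e F z + dird S e G z"
  by (rule dird_eq[OF assms(1,2) has_derivative_add[OF dird_works[OF assms(3)] dird_works[OF assms(4)]]])

lemma dird_diff:
  assumes "thick S" "z \<in> S" "F differentiable (at z within S)" "G differentiable (at z within S)"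
  shows "dird S e (\<lambda>y. F y - G y) z = dird S e F z - dird S e G z"
  by (rule dird_eq[OF assms(1,2) has_derivative_diff[OF dird_works[OF assms(3)] dird_works[OF assms(4)]]])

lemma dird_divide:
  fixes F G :: "'a::euclidean_space \<Rightarrow> real"
  assumes "thick S" "z \<in> S" "F differentiable (at z within S)" "G differentiable (at z within S)" "G z \<noteq> 0"
  shows "dird S e (\<lambda>y. F y / G y) z = (dird S e F z * G z - F z * dird S e G z) / (G z * G z)"
  by (rule dird_eq[OF assms(1,2) has_derivative_divide'[OF dird_works[OF assms(3)] dird_works[OF assms(4)] assms(5)]])

text \<open>
  Coordinate derivatives and time derivatives are both derivatives along a segment that stays in
  the domain, so this lemma relates them to \<open>dird\<close>.
\<close>

lemma has_vector_derivative_along_line: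
  assumes "F differentiable (at (y + \<alpha> *\<^sub>R a) within S)" "\<And>\<beta>. \<beta> \<in> I \<Longrightarrow> y + \<beta> *\<^sub>R a \<in> S"
  shows "((\<lambda>\<beta>. F (y + \<beta> *\<^sub>R a)) has_vector_derivative dird S a F (y + \<alpha> *\<^sub>R a)) (at \<alpha> within I)"
proof -
  let ?D = "\<lambda>e. dird S e F (y + \<alpha> *\<^sub>R a)"
  have 1: "((\<lambda>\<beta>. y + \<beta> *\<^sub>R a) has_derivative (\<lambda>\<beta>. \<beta> *\<^sub>R a)) (at \<alpha> within I)"
    by (auto intro!: derivative_eq_intros)
  have 2: "(F has_derivative ?D) (at (y + \<alpha> *\<^sub>R a) within (\<lambda>\<beta>. y + \<beta> *\<^sub>R a) ` I)"
    using dird_works[OF assms(1)] by (rule has_derivative_subset) (use assms(2) in auto)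
  have "((\<lambda>\<beta>. F (y + \<beta> *\<^sub>R a)) has_derivative (\<lambda>\<beta>. ?D (\<beta> *\<^sub>R a))) (at \<alpha> within I)"
    using has_derivative_in_compose[OF 1 2] by simp
  then show ?thesis
    by (simp add: has_vector_derivative_def linear_cmul[OF linear_dird[OF assms(1)]])
qed

lemma at_within_thick_neq_bot:
  fixes S :: "real set"
  assumes "thick S" "z \<in> S"
  shows "at z within S \<noteq> bot"
proof -
  have "\<exists>x'\<in>S. x' \<noteq> z \<and> \<bar>x' - z\<bar> < e" if e: "e > 0" for e
  proof -
    obtain d where "0 < \<bar>d\<bar>" "\<bar>d\<bar> < e" "z + d *\<^sub>R 1 \<in> S"
      using assms e unfolding thick_def Basis_real_def by blast
    then show ?thesis by (intro bexI[of _ "z + d"]) auto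
  qed
  then have "z islimpt S" by (simp add: islimpt_approachable_real)
  then show ?thesis by (simp add: trivial_limit_within)
qed

lemma deriv_within_eq_dird:
  assumes "thick S" "z \<in> S" "f differentiable (at z within S)"
  shows "deriv_within S f z = dird S 1 f z"
proof -
  have "(f has_vector_derivative dird S 1 f z) (at z within S)"
    using has_vector_derivative_along_line[of f 0 z 1 S S] assms(3) by simp
  then show ?thesis
    unfolding deriv_within_def by (rule vector_derivative_within[OF at_within_thick_neq_bot[OF assms(1,2)]])
qed

section \<open>Smooth functions\<close>

lemma smooth_on_has_derivative:
  assumes "smooth_on S F"
  obtains F' where "\<And>x. x \<in> S \<Longrightarrow> (F has_derivative F' x) (at x within S)" "\<And>u. Ck_on k S (\<lambda>x. F' x u)"
proof -
  have "Ck_on (Suc k) S F" using assms by (simp only: smooth_on_def)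
  then show ?thesis using that by auto
qed

lemma smooth_on_imp_differentiable:
  assumes "smooth_on S F" "z \<in> S"
  shows "F differentiable (at z within S)"
  by (rule smooth_on_has_derivative[OF assms(1), of 0]) (use assms(2) in \<open>auto simp: differentiable_def\<close>)

lemma smooth_on_imp_continuous_on: "smooth_on S F \<Longrightarrow> continuous_on S F"
  unfolding smooth_on_def by (drule spec[of _ 0]) simp

lemma Ck_on_cong:
  assumes "Ck_on k S F" "\<And>z. z \<in> S \<Longrightarrow> F z = G z"
  shows "Ck_on k S G"
proof (cases k)
  case 0
  then show ?thesis using assms by (simp cong: continuous_on_cong)
next
  case (Suc m)
  then obtain F' where F': "\<And>x. x \<in> S \<Longrightarrow> (F has_derivative F' x) (at x within S)"
      "\<And>u. Ck_on m S (\<lambda>x. F' x u)"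
    using assms(1) by auto
  have "(G has_derivative F' x) (at x within S)" if "x \<in> S" for x
    by (rule has_derivative_transform[OF that _ F'(1)[OF that]]) (simp add: assms(2))
  with F'(2) Suc show ?thesis by auto
qed

lemma smooth_on_cong:
  "smooth_on S F \<Longrightarrow> (\<And>z. z \<in> S \<Longrightarrow> F z = G z) \<Longrightarrow> smooth_on S G"
  unfolding smooth_on_def using Ck_on_cong by blast

text \<open>
  In the definition of smoothness the derivative is chosen anew for every order of
  differentiability. On a thick set all these choices agree with \<open>dird\<close>, which is therefore
  differentiable to every order.
\<close>

lemma smooth_on_dird:
  assumes "thick S" "smooth_on S F"
  shows "smooth_on S (dird S e F)"
  unfolding smooth_on_def
proof
  fix k
  obtain F' where F': "\<And>x. x \<in> S \<Longrightarrow> (F has_derivative F' x) (at x within S)" "\<And>u. Ck_on k S (\<lambda>x. F' x u)"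
    using smooth_on_has_derivative[OF assms(2)] by metis
  show "Ck_on k S (dird S e F)"
    by (rule Ck_on_cong[OF F'(2)[of e]]) (rule dird_eq[OF assms(1) _ F'(1), symmetric])
qed

lemma smooth_on_vec:
  fixes F :: "'a::real_normed_vector \<Rightarrow> 'b::euclidean_space ^ 'n"
  assumes "\<And>i. smooth_on S (\<lambda>z. F z $ i)"
  shows "smooth_on S F"
proof -
  have "(\<And>i. Ck_on k S (\<lambda>z. F z $ i)) \<Longrightarrow> Ck_on k S F" for k and F :: "'a \<Rightarrow> 'b ^ 'n"
  proof (induction k arbitrary: F)
    case 0
    then have "continuous_on S (\<lambda>z. \<chi> i. F z $ i)" by (intro continuous_on_vec_lambda) simp
    then show ?case by (simp add: vec_lambda_eta)
  next
    case (Suc k)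
    then have "\<forall>i. \<exists>f'. (\<forall>x\<in>S. ((\<lambda>z. F z $ i) has_derivative f' x) (at x within S)) \<and> (\<forall>u. Ck_on k S (\<lambda>x. f' x u))"
      by simp
    then obtain f' where f': "\<And>i x. x \<in> S \<Longrightarrow> ((\<lambda>z. F z $ i) has_derivative f' i x) (at x within S)"
      "\<And>i u. Ck_on k S (\<lambda>x. f' i x u)" by metis
    have "(F has_derivative (\<lambda>h. \<chi> i. f' i x h)) (at x within S)" if "x \<in> S" for x
      by (rule has_derivative_vec[OF f'(1)[OF that]])
    moreover have "Ck_on k S (\<lambda>x. \<chi> i. f' i x u)" for u
      by (rule Suc.IH) (simp add: f'(2))
    ultimately show ?case by (auto intro!: exI[of _ "\<lambda>x h. \<chi> i. f' i x h"])
  qed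
  then show ?thesis using assms by (simp add: smooth_on_def)
qed

text \<open>
  This turns a tensor that is independent of time into a smooth function on spacetime.
\<close>

lemma smooth_on_fst:
  assumes "smooth_on W f"
  shows "smooth_on (W \<times> I) (\<lambda>z. f (fst z))"
proof -
  have "Ck_on k W f \<Longrightarrow> Ck_on k (W \<times> I) (\<lambda>z. f (fst z))" for k
  proof (induction k arbitrary: f)
    case 0
    then show ?case
      by (auto intro!: continuous_on_compose2[OF _ continuous_on_fst[OF continuous_on_id]])
  next
    case (Suc k)
    then obtain f' where f': "\<And>x. x \<in> W \<Longrightarrow> (f has_derivative f' x) (at x within W)"
      "\<And>u. Ck_on k W (\<lambda>x. f' x u)" by auto
    have "((\<lambda>z. f (fst z)) has_derivative (\<lambda>h. f' (fst z) (fst h))) (at z within W \<times> I)"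
      if "z \<in> W \<times> I" for z
    proof -
      have "(fst has_derivative fst) (at z within W \<times> I)"
        by (intro bounded_linear_imp_has_derivative bounded_linear_fst)
      moreover have "(f has_derivative f' (fst z)) (at (fst z) within fst ` (W \<times> I))"
        by (rule has_derivative_subset[OF f'(1)]) (use that in auto)
      ultimately show ?thesis by (rule has_derivative_in_compose)
    qed
    moreover have "Ck_on k (W \<times> I) (\<lambda>z. f' (fst z) (fst u))" for u
      by (rule Suc.IH[OF f'(2)])
    ultimately show ?case by (auto intro!: exI[of _ "\<lambda>z h. f' (fst z) (fst h)"])
  qed
  then show ?thesis using assms by (simp add: smooth_on_def)
qed

text \<open>
  Chain rule for an outer function on \<open>[0,\<infinity>)\<close>. Its one-sided derivative at \<open>0\<close> suffices because
  the inner function never leaves the half-line.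
\<close>

lemma dird_compose_half_line:
  fixes F :: "'a::euclidean_space \<Rightarrow> real" and k :: "real \<Rightarrow> real"
  assumes S: "thick S" "z \<in> S" and k: "smooth_on {0..} k"
    and F: "F differentiable (at z within S)" "\<And>y. y \<in> S \<Longrightarrow> 0 \<le> F y"
  shows "dird S e (\<lambda>y. k (F y)) z = deriv_within {0..} k (F z) * dird S e F z"
    and "(\<lambda>y. k (F y)) differentiable (at z within S)"
proof -
  have r: "F z \<in> {0..}" using F(2) S(2) by simp
  have dk: "k differentiable (at (F z) within {0..})" by (rule smooth_on_imp_differentiable[OF k r])
  have "(k has_derivative (\<lambda>d. dird {0..} d k (F z))) (at (F z) within F ` S)"
    by (rule has_derivative_subset[OF dird_works[OF dk]]) (use F(2) in auto)
  from has_derivative_in_compose[OF dird_works[OF F(1)] this]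
  have D: "((\<lambda>y. k (F y)) has_derivative (\<lambda>e. dird {0..} (dird S e F z) k (F z))) (at z within S)" .
  then show "(\<lambda>y. k (F y)) differentiable (at z within S)" by (auto simp: differentiable_def)
  have "dird {0..} d k (F z) = deriv_within {0..} k (F z) * d" for d
    using linear_cmul[OF linear_dird[OF dk], of d 1]
    by (simp add: deriv_within_eq_dird[OF thick_half_line r dk])
  then show "dird S e (\<lambda>y. k (F y)) z = deriv_within {0..} k (F z) * dird S e F z"
    using dird_eq[OF S D] by simp
qed

lemma smooth_deriv_half_line:
  assumes "smooth_on {0..} k" shows "smooth_on {0..} (deriv_within {0..} k)"
  by (rule smooth_on_cong[OF smooth_on_dird[OF thick_half_line assms, of 1]])
     (rule deriv_within_eq_dird[OF thick_half_line _ smooth_on_imp_differentiable[OF assms], symmetric])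

section \<open>Symmetry of second derivatives up to the boundary\<close>

text \<open>
  The mean value theorem is applied first in the direction \<open>a\<close>, to the increment in the direction
  \<open>b\<close>, and then in the direction \<open>b\<close>. Only the square spanned at \<open>z\<close> has to lie in \<open>S\<close>, so \<open>z\<close> may be
  a boundary point.
\<close>

lemma second_difference_mean_value:
  fixes F :: "'a::euclidean_space \<Rightarrow> real"
  assumes F: "\<And>y. y \<in> S \<Longrightarrow> F differentiable (at y within S)"
    and Fa: "\<And>y. y \<in> S \<Longrightarrow> dird S a F differentiable (at y within S)"
    and r: "0 < r"
    and sq: "\<And>\<alpha> \<beta>. \<alpha> \<in> {0..r} \<Longrightarrow> \<beta> \<in> {0..r} \<Longrightarrow> z + \<alpha> *\<^sub>R a + \<beta> *\<^sub>R b \<in> S"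
  shows "\<exists>\<alpha>\<in>{0..r}. \<exists>\<beta>\<in>{0..r}. F (z + r *\<^sub>R a + r *\<^sub>R b) - F (z + r *\<^sub>R a) - F (z + r *\<^sub>R b) + F z
           = r\<^sup>2 * dird S b (dird S a F) (z + \<alpha> *\<^sub>R a + \<beta> *\<^sub>R b)"
proof -
  have d1: "((\<lambda>\<alpha>. F ((z + \<beta> *\<^sub>R b) + \<alpha> *\<^sub>R a)) has_vector_derivative
      dird S a F ((z + \<beta> *\<^sub>R b) + \<alpha> *\<^sub>R a)) (at \<alpha> within {0..r})"
    if "\<alpha> \<in> {0..r}" "\<beta> \<in> {0..r}" for \<alpha> \<beta>
    by (rule has_vector_derivative_along_line) (use that sq F in \<open>auto simp: add_ac\<close>)
  let ?\<phi> = "\<lambda>\<alpha>. F ((z + r *\<^sub>R b) + \<alpha> *\<^sub>R a) - F ((z + 0 *\<^sub>R b) + \<alpha> *\<^sub>R a)"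
  have "(?\<phi> has_derivative (\<lambda>h. h * (dird S a F ((z + r *\<^sub>R b) + \<alpha> *\<^sub>R a) - dird S a F ((z + 0 *\<^sub>R b) + \<alpha> *\<^sub>R a))))
      (at \<alpha> within {0..r})" if "\<alpha> \<in> {0..r}" for \<alpha>
    using has_vector_derivative_diff[OF d1[OF that, of r] d1[OF that, of 0]] r
    by (simp add: has_vector_derivative_def)
  from mvt_simple[OF r, of ?\<phi>, OF this] obtain \<alpha> where \<alpha>: "\<alpha> \<in> {0<..<r}" and
    e1: "?\<phi> r - ?\<phi> 0 = r * (dird S a F ((z + r *\<^sub>R b) + \<alpha> *\<^sub>R a) - dird S a F ((z + 0 *\<^sub>R b) + \<alpha> *\<^sub>R a))"
    by auto
  have d2: "((\<lambda>\<beta>. dird S a F ((z + \<alpha> *\<^sub>R a) + \<beta> *\<^sub>R b)) has_derivative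
      (\<lambda>h. h * dird S b (dird S a F) ((z + \<alpha> *\<^sub>R a) + \<beta> *\<^sub>R b))) (at \<beta> within {0..r})"
    if "\<beta> \<in> {0..r}" for \<beta>
    using has_vector_derivative_along_line[of "dird S a F" "z + \<alpha> *\<^sub>R a" \<beta> b S "{0..r}"] that sq Fa \<alpha>
    by (auto simp: has_vector_derivative_def)
  from mvt_simple[OF r, of "\<lambda>\<beta>. dird S a F ((z + \<alpha> *\<^sub>R a) + \<beta> *\<^sub>R b)", OF d2] obtain \<beta> where \<beta>: "\<beta> \<in> {0<..<r}" and
    e2: "dird S a F (z + \<alpha> *\<^sub>R a + r *\<^sub>R b) - dird S a F (z + \<alpha> *\<^sub>R a + 0 *\<^sub>R b)
      = r * dird S b (dird S a F) (z + \<alpha> *\<^sub>R a + \<beta> *\<^sub>R b)"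
    by auto
  show ?thesis
  proof (intro bexI)
    show "F (z + r *\<^sub>R a + r *\<^sub>R b) - F (z + r *\<^sub>R a) - F (z + r *\<^sub>R b) + F z
           = r\<^sup>2 * dird S b (dird S a F) (z + \<alpha> *\<^sub>R a + \<beta> *\<^sub>R b)"
      using e1 e2 by (simp add: power2_eq_square add_ac)
  qed (use \<alpha> \<beta> in auto)
qed

text \<open>
  The second difference is symmetric in \<open>a\<close> and \<open>b\<close>. So in every small square the two mixed
  derivatives share a value, attained at possibly different points, and continuity gives equality
  at the corner \<open>z\<close>.
\<close>

lemma dird_commute_real:
  fixes F :: "'a::euclidean_space \<Rightarrow> real"
  assumes F: "\<And>y. y \<in> S \<Longrightarrow> F differentiable (at y within S)"
    and Fa: "\<And>y. y \<in> S \<Longrightarrow> dird S a F differentiable (at y within S)"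
    and Fb: "\<And>y. y \<in> S \<Longrightarrow> dird S b F differentiable (at y within S)"
    and cab: "continuous_on S (dird S b (dird S a F))"
    and cba: "continuous_on S (dird S a (dird S b F))"
    and r: "0 < r"
    and sq: "\<And>\<alpha> \<beta>. \<alpha> \<in> {0..r} \<Longrightarrow> \<beta> \<in> {0..r} \<Longrightarrow> z + \<alpha> *\<^sub>R a + \<beta> *\<^sub>R b \<in> S"
  shows "dird S a (dird S b F) z = dird S b (dird S a F) z"
proof -
  define \<rho> where "\<rho> n = r / real (Suc n)" for n
  have \<rho>: "0 < \<rho> n" "\<rho> n \<le> r" for n
    using r by (auto simp: \<rho>_def field_simps)
  have \<rho>0: "\<rho> \<longlonglongrightarrow> 0"
    unfolding \<rho>_def by (rule LIMSEQ_Suc[OF lim_const_over_n])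
  have "\<exists>\<alpha> \<beta> \<alpha>' \<beta>'. \<alpha> \<in> {0..\<rho> n} \<and> \<beta> \<in> {0..\<rho> n} \<and> \<alpha>' \<in> {0..\<rho> n} \<and> \<beta>' \<in> {0..\<rho> n} \<and>
     dird S b (dird S a F) (z + \<alpha> *\<^sub>R a + \<beta> *\<^sub>R b) = dird S a (dird S b F) (z + \<alpha>' *\<^sub>R a + \<beta>' *\<^sub>R b)" for n
  proof -
    obtain \<alpha> \<beta> where 1: "\<alpha> \<in> {0..\<rho> n}" "\<beta> \<in> {0..\<rho> n}"
      "F (z + \<rho> n *\<^sub>R a + \<rho> n *\<^sub>R b) - F (z + \<rho> n *\<^sub>R a) - F (z + \<rho> n *\<^sub>R b) + F z
           = (\<rho> n)\<^sup>2 * dird S b (dird S a F) (z + \<alpha> *\<^sub>R a + \<beta> *\<^sub>R b)"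
      using second_difference_mean_value[OF F Fa \<rho>(1)[of n], of z b] sq \<rho>(2)[of n] by auto
    have "\<exists>\<beta>\<in>{0..\<rho> n}. \<exists>\<alpha>\<in>{0..\<rho> n}.
      F (z + \<rho> n *\<^sub>R b + \<rho> n *\<^sub>R a) - F (z + \<rho> n *\<^sub>R b) - F (z + \<rho> n *\<^sub>R a) + F z
           = (\<rho> n)\<^sup>2 * dird S a (dird S b F) (z + \<beta> *\<^sub>R b + \<alpha> *\<^sub>R a)"
    proof (rule second_difference_mean_value[OF F Fb \<rho>(1)])
      fix \<beta> \<alpha> assume "\<beta> \<in> {0..\<rho> n}" "\<alpha> \<in> {0..\<rho> n}"
      with \<rho>(2)[of n] have "z + \<alpha> *\<^sub>R a + \<beta> *\<^sub>R b \<in> S" by (intro sq) auto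
      then show "z + \<beta> *\<^sub>R b + \<alpha> *\<^sub>R a \<in> S" by (simp add: add_ac)
    qed
    then obtain \<beta>' \<alpha>' where 2: "\<beta>' \<in> {0..\<rho> n}" "\<alpha>' \<in> {0..\<rho> n}"
      "F (z + \<rho> n *\<^sub>R b + \<rho> n *\<^sub>R a) - F (z + \<rho> n *\<^sub>R b) - F (z + \<rho> n *\<^sub>R a) + F z
           = (\<rho> n)\<^sup>2 * dird S a (dird S b F) (z + \<beta>' *\<^sub>R b + \<alpha>' *\<^sub>R a)"
      by blast
    have swap: "z + \<rho> n *\<^sub>R b + \<rho> n *\<^sub>R a = z + \<rho> n *\<^sub>R a + \<rho> n *\<^sub>R b"
      "z + \<beta>' *\<^sub>R b + \<alpha>' *\<^sub>R a = z + \<alpha>' *\<^sub>R a + \<beta>' *\<^sub>R b"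
      by (simp_all add: add_ac)
    have "(\<rho> n)\<^sup>2 * dird S b (dird S a F) (z + \<alpha> *\<^sub>R a + \<beta> *\<^sub>R b)
        = (\<rho> n)\<^sup>2 * dird S a (dird S b F) (z + \<alpha>' *\<^sub>R a + \<beta>' *\<^sub>R b)"
      using 1(3) 2(3) unfolding swap by linarith
    then have "dird S b (dird S a F) (z + \<alpha> *\<^sub>R a + \<beta> *\<^sub>R b) = dird S a (dird S b F) (z + \<alpha>' *\<^sub>R a + \<beta>' *\<^sub>R b)"
      using \<rho>(1)[of n] by simp
    with 1 2 show ?thesis by blast
  qed
  then obtain \<alpha> \<beta> \<alpha>' \<beta>' where I: "\<And>n. \<alpha> n \<in> {0..\<rho> n}" "\<And>n. \<beta> n \<in> {0..\<rho> n}"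
     "\<And>n. \<alpha>' n \<in> {0..\<rho> n}" "\<And>n. \<beta>' n \<in> {0..\<rho> n}"
     and eq: "\<And>n. dird S b (dird S a F) (z + \<alpha> n *\<^sub>R a + \<beta> n *\<^sub>R b)
        = dird S a (dird S b F) (z + \<alpha>' n *\<^sub>R a + \<beta>' n *\<^sub>R b)"
    by metis
  have null: "\<xi> \<longlonglongrightarrow> 0" if "\<And>n. \<xi> n \<in> {0..\<rho> n}" for \<xi> :: "nat \<Rightarrow> real"
    by (rule tendsto_sandwich[OF _ _ tendsto_const \<rho>0]) (use that in \<open>auto\<close>)
  have lim: "(\<lambda>n. G (z + \<xi> n *\<^sub>R a + \<eta> n *\<^sub>R b)) \<longlonglongrightarrow> G z"
    if "continuous_on S G" "\<And>n. \<xi> n \<in> {0..\<rho> n}" "\<And>n. \<eta> n \<in> {0..\<rho> n}" for G :: "'a \<Rightarrow> real" and \<xi> \<eta>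
  proof (rule continuous_on_tendsto_compose[OF that(1)])
    have "(\<lambda>n. z + \<xi> n *\<^sub>R a + \<eta> n *\<^sub>R b) \<longlonglongrightarrow> z + 0 *\<^sub>R a + 0 *\<^sub>R b"
      by (intro tendsto_intros null that)
    then show "(\<lambda>n. z + \<xi> n *\<^sub>R a + \<eta> n *\<^sub>R b) \<longlonglongrightarrow> z" by simp
    show "z \<in> S" using sq[of 0 0] r by simp
    have "z + \<xi> n *\<^sub>R a + \<eta> n *\<^sub>R b \<in> S" for n
      using that(2)[of n] that(3)[of n] \<rho>(2)[of n] by (intro sq) auto
    then show "\<forall>\<^sub>F n in sequentially. z + \<xi> n *\<^sub>R a + \<eta> n *\<^sub>R b \<in> S" by simp
  qed
  show ?thesis
    using LIMSEQ_unique[OF lim[OF cba I(3,4)]] lim[OF cab I(1,2)] unfolding eq by blast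
qed

lemma dird_commute:
  fixes F :: "'a::euclidean_space \<Rightarrow> 'b::euclidean_space"
  assumes thick: "thick S" and F: "smooth_on S F" and r: "0 < r"
    and sq: "\<And>\<alpha> \<beta>. \<alpha> \<in> {0..r} \<Longrightarrow> \<beta> \<in> {0..r} \<Longrightarrow> z + \<alpha> *\<^sub>R a + \<beta> *\<^sub>R b \<in> S"
  shows "dird S a (dird S b F) z = dird S b (dird S a F) z"
proof (rule euclidean_eqI)
  fix k :: 'b
  have bl: "bounded_linear (\<lambda>x::'b. x \<bullet> k)" by (rule bounded_linear_inner_left)
  have z: "z \<in> S" using sq[of 0 0] r by simp
  have c1: "dird S e (\<lambda>y. K y \<bullet> k) y = dird S e K y \<bullet> k"
    if "smooth_on S K" "y \<in> S" for K :: "'a \<Rightarrow> 'b" and y e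
    by (rule dird_bounded_linear[OF thick that(2) bl smooth_on_imp_differentiable[OF that]])
  have c2: "dird S e' (dird S e (\<lambda>y. F y \<bullet> k)) y = dird S e' (dird S e F) y \<bullet> k" if "y \<in> S" for e e' y
    using c1[OF smooth_on_dird[OF thick F] that] by (subst dird_cong[OF c1[OF F] that]) simp_all
  have d: "(\<lambda>y. K y \<bullet> k) differentiable (at y within S)" if "smooth_on S K" "y \<in> S" for K :: "'a \<Rightarrow> 'b" and y
    using bounded_linear.has_derivative[OF bl] smooth_on_imp_differentiable[OF that]
    unfolding differentiable_def by blast
  have d1: "dird S e (\<lambda>y. F y \<bullet> k) differentiable (at y within S)" if "y \<in> S" for e y
    by (rule differentiable_transform_within[OF d[OF smooth_on_dird[OF thick F, of e] that] zero_less_one that])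
       (simp add: c1[OF F])
  have c: "continuous_on S (dird S e' (dird S e (\<lambda>y. F y \<bullet> k)))" for e e'
  proof -
    have "continuous_on S (\<lambda>y. dird S e' (dird S e F) y \<bullet> k)"
      by (intro continuous_on_inner continuous_on_const smooth_on_imp_continuous_on smooth_on_dird thick F)
    then show ?thesis by (simp add: c2 cong: continuous_on_cong)
  qed
  have "dird S a (dird S b (\<lambda>y. F y \<bullet> k)) z = dird S b (dird S a (\<lambda>y. F y \<bullet> k)) z"
    by (rule dird_commute_real[OF d[OF F] d1 d1 c c r sq])
  then show "dird S a (dird S b F) z \<bullet> k = dird S b (dird S a F) z \<bullet> k"
    using c2[OF z] by simp
qed

text \<open>
  At \<open>t = T\<close> a square with a side pointing to the future leaves the domain. Reversing that side
  brings it back into the domain and only changes the sign of both mixed derivatives.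
\<close>

lemma dird_commute_parabolic:
  fixes W :: "(real ^ 'n) set" and F :: "(real ^ 'n) \<times> real \<Rightarrow> 'b::euclidean_space"
    and T :: real
  defines "S \<equiv> W \<times> {0<..T}"
  assumes W: "open W" and T: "0 < T" and F: "smooth_on S F" and z: "z \<in> S"
  shows "dird S a (dird S b F) z = dird S b (dird S a F) z"
proof -
  have thick: "thick S" unfolding S_def by (rule thick_open_times_interval[OF W T])
  have neg: "dird S (-e) K y = - dird S e K y" if "smooth_on S K" "y \<in> S" for K :: "_ \<Rightarrow> 'b" and e y
    by (rule linear_neg[OF linear_dird[OF smooth_on_imp_differentiable[OF that]]])
  have neg2: "dird S a (dird S (-b) F) z = - dird S a (dird S b F) z" for a b
  proof -
    have "dird S a (dird S (-b) F) z = dird S a (\<lambda>y. - dird S b F y) z"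
      by (rule dird_cong[OF neg[OF F] z])
    also have "\<dots> = - dird S a (dird S b F) z"
      by (rule dird_bounded_linear[OF thick z bounded_linear_minus[OF bounded_linear_ident]])
         (intro smooth_on_imp_differentiable smooth_on_dird thick F z)
    finally show ?thesis .
  qed
  have main: "dird S a (dird S b F) z = dird S b (dird S a F) z" if "snd a \<le> 0" "snd b \<le> 0" for a b
  proof -
    obtain \<delta> where \<delta>: "\<delta> > 0" "ball (fst z) \<delta> \<subseteq> W"
      using W z by (auto simp: open_contains_ball S_def)
    define m where "m = min \<delta> (snd z)"
    have m: "m > 0" using \<delta> z by (auto simp: m_def S_def)
    \<comment> \<open>The side of the square is so small that \<open>\<alpha> a + \<beta> b\<close> leaves neither the ball in \<open>W\<close> nor \<open>t > 0\<close>.\<close>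
    define N where "N = norm a + norm b + 1"
    define r where "r = m / N"
    have N: "N > 0" unfolding N_def by (intro add_nonneg_pos) simp_all
    have r: "r > 0" using m N by (simp add: r_def)
    have "r * N = m" using N by (simp add: r_def)
    then have rm: "r * norm a + r * norm b < m"
      using r by (simp add: N_def distrib_left)
    show ?thesis
    proof (rule dird_commute[OF thick F r])
      fix \<alpha> \<beta> assume ab: "\<alpha> \<in> {0..r}" "\<beta> \<in> {0..r}"
      define w where "w = \<alpha> *\<^sub>R a + \<beta> *\<^sub>R b"
      have "norm w \<le> \<alpha> * norm a + \<beta> * norm b"
        using ab unfolding w_def by (intro order_trans[OF norm_triangle_ineq]) auto
      also have "\<dots> \<le> r * norm a + r * norm b"
        using ab by (intro add_mono mult_right_mono) auto
      also note rm
      finally have w: "norm w < m" .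
      have "norm (fst w) < \<delta>" "\<bar>snd w\<bar> < snd z"
        using w norm_fst_le[of "fst w" "snd w"] norm_snd_le[of "snd w" "fst w"] by (simp_all add: m_def)
      moreover have "snd w \<le> 0"
        using that ab by (auto simp: w_def intro!: add_nonpos_nonpos mult_nonneg_nonpos)
      moreover have "fst z + fst w \<in> ball (fst z) \<delta>"
        using \<open>norm (fst w) < \<delta>\<close> by (simp add: dist_norm)
      ultimately have "fst z + fst w \<in> W" "snd z + snd w \<in> {0<..T}"
        using \<delta>(2) z unfolding S_def by (blast, cases z, simp)
      then show "z + \<alpha> *\<^sub>R a + \<beta> *\<^sub>R b \<in> S"
        by (simp add: S_def w_def mem_Times_iff add.assoc)
    qed
  qed
  have neg1: "dird S (-a) (dird S b F) z = - dird S a (dird S b F) z" for a b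
    by (rule neg[OF smooth_on_dird[OF thick F] z])
  consider "snd a \<le> 0" "snd b \<le> 0" | "snd (-a) \<le> 0" "snd b \<le> 0"
    | "snd a \<le> 0" "snd (-b) \<le> 0" | "snd (-a) \<le> 0" "snd (-b) \<le> 0"
    by (cases "snd a \<le> 0"; cases "snd b \<le> 0") auto
  then show ?thesis
  proof cases
    case 1
    then show ?thesis by (rule main)
  next
    case 2
    from main[OF 2] show ?thesis unfolding neg1 neg2 by (simp only: neg_equal_iff_equal)
  next
    case 3
    from main[OF 3] show ?thesis unfolding neg1 neg2 by (simp only: neg_equal_iff_equal)
  next
    case 4
    from main[OF 4] show ?thesis unfolding neg1 neg2 by (simp only: neg_equal_iff_equal)
  qed
qed

section \<open>Matrices\<close>

lemma bounded_bilinear_matrix_mult: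
  "bounded_bilinear ((**) :: real^'n^'m \<Rightarrow> real^'p^'n \<Rightarrow> real^'p^'m)"
  unfolding bilinear_conv_bounded_bilinear[symmetric] bilinear_def
  by (auto intro!: linearI simp: vec_eq_iff matrix_matrix_mult_def sum.distrib sum_distrib_left algebra_simps)

lemma bounded_bilinear_matrix_vector_mult:
  "bounded_bilinear ((*v) :: real^'n^'m \<Rightarrow> real^'n \<Rightarrow> real^'m)"
  unfolding bilinear_conv_bounded_bilinear[symmetric] bilinear_def
  by (auto intro!: linearI simp: vec_eq_iff matrix_vector_mult_def sum.distrib sum_distrib_left algebra_simps)

lemma bounded_bilinear_vector_matrix_mult:
  "bounded_bilinear ((v*) :: real^'m \<Rightarrow> real^'n^'m \<Rightarrow> real^'n)"
  unfolding bilinear_conv_bounded_bilinear[symmetric] bilinear_def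
  by (auto intro!: linearI simp: vec_eq_iff vector_matrix_mult_def sum.distrib sum_distrib_left algebra_simps)

lemma bounded_linear_transpose:
  "bounded_linear (transpose :: real^'n^'m \<Rightarrow> real^'m^'n)"
  by (intro linear_conv_bounded_linear[THEN iffD1] linearI) (auto simp: transpose_def vec_eq_iff)

interpretation mm: bounded_bilinear "(**) :: real^'n^'m \<Rightarrow> real^'p^'n \<Rightarrow> real^'p^'m"
  by (rule bounded_bilinear_matrix_mult)
interpretation mv: bounded_bilinear "(*v) :: real^'n^'m \<Rightarrow> real^'n \<Rightarrow> real^'m"
  by (rule bounded_bilinear_matrix_vector_mult)
interpretation vm: bounded_bilinear "(v*) :: real^'m \<Rightarrow> real^'n^'m \<Rightarrow> real^'n"
  by (rule bounded_bilinear_vector_matrix_mult)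
lemmas transpose_add = linear_add[OF bounded_linear.linear[OF bounded_linear_transpose]]
lemmas transpose_diff = linear_diff[OF bounded_linear.linear[OF bounded_linear_transpose]]

text \<open>
  The inner product of matrices is the full contraction \<open>\<Sum>\<^sub>i\<^sub>j A\<^sub>i\<^sub>j B\<^sub>i\<^sub>j\<close>, so traces against a metric
  are inner products and a factor moves to the other side as its transpose.
\<close>

lemma inner_matrix_mult_left:
  fixes A :: "real^'n^'m" and B :: "real^'k^'m" and C :: "real^'n^'k"
  shows "A \<bullet> (B ** C) = (transpose B ** A) \<bullet> C"
proof -
  have "A \<bullet> (B ** C) = (\<Sum>i\<in>UNIV. \<Sum>j\<in>UNIV. \<Sum>k\<in>UNIV. A$i$j * (B$i$k * C$k$j))"
    by (simp add: inner_vec_def matrix_matrix_mult_def sum_distrib_left)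
  also have "\<dots> = (\<Sum>i\<in>UNIV. \<Sum>k\<in>UNIV. \<Sum>j\<in>UNIV. A$i$j * (B$i$k * C$k$j))"
    by (rule sum.cong[OF refl], rule sum.swap)
  also have "\<dots> = (\<Sum>k\<in>UNIV. \<Sum>i\<in>UNIV. \<Sum>j\<in>UNIV. A$i$j * (B$i$k * C$k$j))"
    by (rule sum.swap)
  also have "\<dots> = (\<Sum>k\<in>UNIV. \<Sum>j\<in>UNIV. \<Sum>i\<in>UNIV. A$i$j * (B$i$k * C$k$j))"
    by (rule sum.cong[OF refl], rule sum.swap)
  also have "\<dots> = (transpose B ** A) \<bullet> C"
    by (simp add: inner_vec_def matrix_matrix_mult_def sum_distrib_left sum_distrib_right transpose_def mult_ac)
  finally show ?thesis .
qed

lemma inner_transpose: "transpose A \<bullet> transpose B = A \<bullet> (B :: real^'n^'m)"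
  unfolding inner_vec_def transpose_def by simp (rule sum.swap)

lemma inner_matrix_mult_right:
  fixes A :: "real^'n^'m" and B :: "real^'k^'m" and C :: "real^'n^'k"
  shows "A \<bullet> (B ** C) = (A ** transpose C) \<bullet> B"
  using inner_matrix_mult_left[of "transpose A" "transpose C" "transpose B"]
  by (metis inner_transpose inner_commute matrix_transpose_mul transpose_transpose)

lemma axis_vector_matrix: "axis i (1::real) v* M = M $ i"
proof -
  have "axis i (1::real) v* M = transpose M *v axis i 1" by simp
  also have "\<dots> = M $ i" unfolding matrix_vector_mult_basis by (simp add: column_def transpose_def vec_eq_iff)
  finally show ?thesis .
qed

lemma sym_matrix_axis: "transpose M = M \<Longrightarrow> M *v axis i (1::real) = M $ i"
  by (metis axis_vector_matrix transpose_matrix_vector)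

lemma differentiable_prod_finite:
  fixes F :: "'i \<Rightarrow> 'a::real_normed_vector \<Rightarrow> real"
  assumes "finite I" "\<And>i. i \<in> I \<Longrightarrow> F i differentiable (at z within S)"
  shows "(\<lambda>z. \<Prod>i\<in>I. F i z) differentiable (at z within S)"
  using assms by (induction I rule: finite_induct) auto

lemma differentiable_det:
  fixes A :: "'a::real_normed_vector \<Rightarrow> real^'n^'n"
  assumes "\<And>i j. (\<lambda>z. A z $ i $ j) differentiable (at z within S)"
  shows "(\<lambda>z. det (A z)) differentiable (at z within S)"
  unfolding det_def
  by (intro differentiable_sum differentiable_mult differentiable_const differentiable_prod_finite ballI assms)
     (auto intro: finite_permutations)

lemma matrix_inv_mult:
  fixes A :: "real^'n^'n"
  assumes "invertible A"
  shows "A ** matrix_inv A = mat 1" "matrix_inv A ** A = mat 1"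
proof -
  have "A ** matrix_inv A = mat 1 \<and> matrix_inv A ** A = mat 1"
    unfolding matrix_inv_def by (rule someI_ex) (use assms in \<open>simp add: invertible_def\<close>)
  then show "A ** matrix_inv A = mat 1" "matrix_inv A ** A = mat 1" by simp_all
qed

text \<open>
  By Cramer's rule the entries of the inverse are quotients of determinants.
\<close>

lemma differentiable_matrix_inv:
  fixes A :: "'a::real_normed_vector \<Rightarrow> real^'n^'n"
  assumes A: "A differentiable (at z within S)" and inv: "\<And>y. y \<in> S \<Longrightarrow> invertible (A y)" and z: "z \<in> S"
  shows "(\<lambda>y. matrix_inv (A y)) differentiable (at z within S)"
proof (intro differentiable_vec)
  fix k b
  have eq: "matrix_inv (A y) $ k $ b = det (\<chi> i j. if j = k then axis b 1 $ i else A y $ i $ j) / det (A y)"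
    if "y \<in> S" for y
  proof -
    have "A y *v (matrix_inv (A y) *v axis b 1) = axis b 1"
      by (simp add: matrix_vector_mul_assoc matrix_inv_mult[OF inv[OF that]])
    then have "matrix_inv (A y) *v axis b 1 = (\<chi> k. det(\<chi> i j. if j=k then axis b 1 $ i else A y $ i $ j) / det (A y))"
      using cramer[of "A y"] inv[OF that] by (simp add: invertible_det_nz)
    then have "(matrix_inv (A y) *v axis b 1) $ k = det(\<chi> i j. if j=k then axis b 1 $ i else A y $ i $ j) / det (A y)"
      by simp
    then show ?thesis by (simp add: matrix_vector_mult_basis column_def)
  qed
  have A': "(\<lambda>y. A y $ i $ j) differentiable (at z within S)" for i j
    using A bounded_linear.has_derivative[OF bounded_linear_compose[OF bounded_linear_vec_nth bounded_linear_vec_nth]]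
    unfolding differentiable_def by blast
  have "(\<lambda>y. det (\<chi> i j. if j = k then axis b 1 $ i else A y $ i $ j) / det (A y)) differentiable (at z within S)"
  proof (rule differentiable_divide)
    show "(\<lambda>y. det (\<chi> i j. if j = k then axis b 1 $ i else A y $ i $ j)) differentiable (at z within S)"
    proof (rule differentiable_det)
      show "(\<lambda>y. (\<chi> i j. if j = k then axis b 1 $ i else A y $ i $ j) $ i $ j) differentiable (at z within S)" for i j
        by (cases "j = k") (simp_all add: A')
    qed
    show "(\<lambda>y. det (A y)) differentiable (at z within S)" by (rule differentiable_det[OF A'])
    show "det (A z) \<noteq> 0" using inv[OF z] by (simp add: invertible_det_nz)
  qed
  then show "(\<lambda>y. matrix_inv (A y) $ k $ b) differentiable (at z within S)"
    by (rule differentiable_transform_within[OF _ zero_less_one z]) (simp add: eq)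
qed

lemma linear_eq_on_space_and_time:
  fixes f k :: "(real ^ 'n) \<times> real \<Rightarrow> 'b::real_vector"
  assumes "linear f" "linear k" "\<And>i. f (axis i 1, 0) = k (axis i 1, 0)" "f (0, 1) = k (0, 1)"
  shows "f e = k e"
proof -
  have "f = k"
    by (rule linear_eq_stdbasis[OF assms(1,2)]) (use assms(3,4) in \<open>auto simp: Basis_prod_def Basis_vec_def\<close>)
  then show ?thesis by simp
qed

lemma linear_eq_on_space:
  fixes f k :: "real ^ 'n \<Rightarrow> 'b::real_vector"
  assumes "linear f" "linear k" "\<And>i. f (axis i 1) = k (axis i 1)"
  shows "f X = k X"
proof -
  have "f = k"
    by (rule linear_eq_stdbasis[OF assms(1,2)]) (use assms(3) in \<open>auto simp: Basis_vec_def\<close>)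
  then show ?thesis by simp
qed

section \<open>The metric and its connection in a chart\<close>

text \<open>
  All tensors are read in one chart and pulled back to \<open>W \<times> (0,T]\<close>, where \<open>W\<close> is the image of the
  chart. They become matrix- or vector-valued functions of \<open>z = (y,t)\<close>, and one calculus of
  directional derivatives covers space and time.
\<close>

locale metric_chart =
  fixes c :: "('a, 'n::finite) chart" and g :: "('a, 'n) metric" and T :: real
  assumes open_image: "open (cmap c ` cdom c)"
    and inj_cmap: "inj_on (cmap c) (cdom c)"
    and smooth_metric: "smooth_on (cmap c ` cdom c) (g c \<circ> cinv c)"
    and metric_sym: "x \<in> cdom c \<Longrightarrow> transpose (g c x) = g c x"
    and metric_pos: "x \<in> cdom c \<Longrightarrow> u \<noteq> 0 \<Longrightarrow> u \<bullet> (g c x *v u) > 0"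
    and T_pos: "0 < T"
begin

definition S :: "((real ^ 'n) \<times> real) set" where "S = cmap c ` cdom c \<times> {0<..T}"

abbreviation pt :: "(real ^ 'n) \<times> real \<Rightarrow> 'a" where "pt z \<equiv> cinv c (fst z)"
abbreviation E :: "'n \<Rightarrow> (real ^ 'n) \<times> real" where "E i \<equiv> (axis i 1, 0)"
abbreviation "D \<equiv> dird S"
abbreviation "dif F z \<equiv> F differentiable (at z within S)"

definition metric :: "(real ^ 'n) \<times> real \<Rightarrow> real ^ 'n ^ 'n" where
  "metric z = g c (pt z)"

definition inv_metric :: "(real ^ 'n) \<times> real \<Rightarrow> real ^ 'n ^ 'n" where
  "inv_metric z = g_inv g c (pt z)"

text \<open>
  The connection matrix \<open>\<Gamma>\<^sub>e\<close> with entries \<open>e\<^sup>k \<Gamma>\<^sup>a\<^sub>k\<^sub>b\<close>. It is linear in the spacetime direction \<open>e\<close>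
  and vanishes on \<open>\<partial>\<^sub>t\<close>, as it should for a static metric; so one formula gives the covariant
  derivative in space and the ordinary derivative in time.
\<close>

definition Gam :: "(real ^ 'n) \<times> real \<Rightarrow> (real ^ 'n) \<times> real \<Rightarrow> real ^ 'n ^ 'n" where
  "Gam e z = (\<chi> a b. \<Sum>k\<in>UNIV. fst e $ k * christoffel g c a k b (pt z))"

lemma thick_S: "thick S"
  unfolding S_def by (rule thick_open_times_interval[OF open_image T_pos])

lemma cmap_pt: "z \<in> S \<Longrightarrow> cmap c (pt z) = fst z"
  by (auto simp: S_def cinv_def f_inv_into_f)

lemma pt_in: "z \<in> S \<Longrightarrow> pt z \<in> cdom c"
  by (auto simp: S_def cinv_def inv_into_into)

lemma pt_cmap: "x \<in> cdom c \<Longrightarrow> pt (cmap c x, t) = x"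
  using inj_cmap by (simp add: cinv_def)

lemma g_inner_eq: "g_inner g c x X Y = X \<bullet> (g c x *v Y)"
  by (simp add: g_inner_def inner_vec_def matrix_vector_mult_def sum_distrib_left mult_ac)

lemma grad_eq:
  assumes "\<And>i. pd c i f x = w $ i" shows "grad g c f x = g_inv g c x *v w"
  by (simp add: grad_def matrix_vector_mult_def assms vec_eq_iff)

lemmas D_commute = dird_commute_parabolic[OF open_image T_pos, folded S_def]
lemmas D_linear = dird_bounded_linear[OF thick_S]
lemmas D_bilinear = dird_bounded_bilinear[OF thick_S]
lemmas D_add = dird_add[OF thick_S]
lemmas D_diff = dird_diff[OF thick_S]
lemmas D_const = dird_const[OF thick_S]
lemmas D_nth = D_linear[OF _ bounded_linear_vec_nth]
lemmas D_transpose = D_linear[OF _ bounded_linear_transpose]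
lemmas D_mm = D_bilinear[OF _ bounded_bilinear_matrix_mult]
lemmas D_mv = D_bilinear[OF _ bounded_bilinear_matrix_vector_mult]
lemmas D_vm = D_bilinear[OF _ bounded_bilinear_vector_matrix_mult]
lemmas D_inner = D_bilinear[OF _ bounded_bilinear_inner]
lemmas dif_nth = differentiable_bounded_linear[OF bounded_linear_vec_nth]
lemmas dif_transpose = differentiable_bounded_linear[OF bounded_linear_transpose]
lemmas dif_mm = differentiable_bounded_bilinear[OF bounded_bilinear_matrix_mult]
lemmas dif_mv = differentiable_bounded_bilinear[OF bounded_bilinear_matrix_vector_mult]
lemmas dif_vm = differentiable_bounded_bilinear[OF bounded_bilinear_vector_matrix_mult]
lemmas dif_inner = differentiable_bounded_bilinear[OF bounded_bilinear_inner]
lemmas smooth_D = smooth_on_dird[OF thick_S]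
lemmas smooth_dif = smooth_on_imp_differentiable

lemma dif_cong:
  assumes "dif F z" "z \<in> S" "\<And>y. y \<in> S \<Longrightarrow> F y = G y"
  shows "dif G z"
  by (rule differentiable_transform_within[OF assms(1) zero_less_one assms(2)]) (simp add: assms(3))

lemma pd_eq_D:
  fixes \<phi> :: "real \<Rightarrow> 'a \<Rightarrow> real"
  assumes z: "z \<in> S" and d: "dif (\<lambda>z. \<phi> (snd z) (pt z)) z"
  shows "pd c i (\<phi> (snd z)) (pt z) = D (E i) (\<lambda>z. \<phi> (snd z) (pt z)) z"
proof -
  let ?F = "\<lambda>z. \<phi> (snd z) (pt z)"
  define I where "I = (\<lambda>r. fst z + r *\<^sub>R axis i 1) -` (cmap c ` cdom c)"
  have "open I"
    unfolding I_def by (intro open_vimage[OF open_image] continuous_intros)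
  have 0: "0 \<in> I" using z by (auto simp: I_def S_def)
  have "((\<lambda>r. ?F (z + r *\<^sub>R E i)) has_vector_derivative D (E i) ?F (z + 0 *\<^sub>R E i)) (at 0 within I)"
    by (rule has_vector_derivative_along_line) (use d z in \<open>auto simp: I_def S_def mem_Times_iff zero_prod_def[symmetric]\<close>)
  then have "((\<lambda>r. \<phi> (snd z) (cinv c (fst z + r *\<^sub>R axis i 1))) has_vector_derivative D (E i) ?F z) (at 0)"
    using at_within_open[OF 0 \<open>open I\<close>] by (simp add: zero_prod_def[symmetric])
  then show ?thesis
    unfolding pd_def cmap_pt[OF z] by (intro DERIV_imp_deriv) (simp add: has_real_derivative_iff_has_vector_derivative)
qed

lemma time_derivative:
  assumes z: "z \<in> S" and d: "dif F z"
  shows "((\<lambda>\<tau>. F (fst z, \<tau>)) has_vector_derivative D (0,1) F z) (at (snd z) within {0<..T})"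
proof -
  have "((\<lambda>\<tau>. F ((fst z, 0) + \<tau> *\<^sub>R (0,1))) has_vector_derivative
      D (0,1) F ((fst z, 0) + snd z *\<^sub>R (0,1))) (at (snd z) within {0<..T})"
    by (rule has_vector_derivative_along_line) (use d z in \<open>auto simp: S_def\<close>)
  then show ?thesis by simp
qed

lemma time_not_bot: "z \<in> S \<Longrightarrow> at (snd z) within {0<..T} \<noteq> bot"
  by (rule at_within_thick_neq_bot[OF thick_Ioc]) (auto simp: S_def)

lemma dt_eq_D:
  assumes z: "z \<in> S" and d: "dif (\<lambda>z. \<phi> (snd z) (pt z)) z"
  shows "dt T \<phi> (snd z) (pt z) = D (0,1) (\<lambda>z. \<phi> (snd z) (pt z)) z"
  unfolding dt_def deriv_within_def
  using vector_derivative_within[OF time_not_bot[OF z] time_derivative[OF z d]] by simp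

lemma D_time_static:
  assumes z: "z \<in> S" and d: "dif (\<lambda>z. F (fst z)) z"
  shows "D (0,1) (\<lambda>z. F (fst z)) z = 0"
proof -
  have "((\<lambda>\<tau>::real. F (fst z)) has_vector_derivative 0) (at (snd z) within {0<..T})"
    by (rule has_vector_derivative_const)
  then show ?thesis
    using vector_derivative_unique_within[OF time_not_bot[OF z] time_derivative[OF z d]] by simp
qed

lemma smooth_metric_S: "smooth_on S metric"
proof -
  have "smooth_on S (\<lambda>z. (g c \<circ> cinv c) (fst z))"
    unfolding S_def by (rule smooth_on_fst[OF smooth_metric])
  then show ?thesis by (simp add: metric_def[abs_def])
qed

lemma metric_S_sym: "z \<in> S \<Longrightarrow> transpose (metric z) = metric z"
  by (simp add: metric_def metric_sym pt_in)

lemma D_metric_sym: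
  assumes "z \<in> S" shows "transpose (D e metric z) = D e metric z"
proof -
  have "transpose (D e metric z) = D e (\<lambda>z. transpose (metric z)) z"
    by (rule D_transpose[symmetric, OF assms smooth_dif[OF smooth_metric_S assms]])
  also have "\<dots> = D e metric z" by (rule dird_cong[OF metric_S_sym assms])
  finally show ?thesis .
qed

lemma invertible_metric:
  assumes "z \<in> S" shows "invertible (metric z)"
proof -
  have "\<forall>u. metric z *v u = 0 \<longrightarrow> u = 0"
    using metric_pos[OF pt_in[OF assms]] unfolding metric_def by (metis inner_zero_right less_irrefl)
  then show ?thesis
    using invertible_left_inverse matrix_left_invertible_ker by blast
qed

lemma metric_inv_metric: "z \<in> S \<Longrightarrow> metric z ** inv_metric z = mat 1"
  and inv_metric_metric: "z \<in> S \<Longrightarrow> inv_metric z ** metric z = mat 1"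
  using matrix_inv_mult[OF invertible_metric] by (simp_all add: metric_def inv_metric_def g_inv_def)

lemma inv_metric_sym:
  assumes z: "z \<in> S" shows "transpose (inv_metric z) = inv_metric z"
proof -
  have "transpose (inv_metric z) ** metric z = transpose (metric z ** inv_metric z)"
    by (simp add: matrix_transpose_mul metric_S_sym[OF z])
  then have "transpose (inv_metric z) ** metric z = mat 1" by (simp add: metric_inv_metric[OF z])
  then have "(transpose (inv_metric z) ** metric z) ** inv_metric z = inv_metric z" by simp
  then show ?thesis by (simp add: matrix_mul_assoc[symmetric] metric_inv_metric[OF z])
qed

lemma inv_metric_inner:
  "z \<in> S \<Longrightarrow> x \<bullet> (inv_metric z *v y) = (inv_metric z *v x) \<bullet> y"
  using inv_metric_sym[of z] transpose_matrix_vector[of "inv_metric z" x] by (simp add: dot_lmul_matrix[symmetric])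

lemma dif_metric: "z \<in> S \<Longrightarrow> dif metric z"
  by (rule smooth_dif[OF smooth_metric_S])

lemma dif_inv_metric: assumes "z \<in> S" shows "dif inv_metric z"
proof -
  have "inv_metric = (\<lambda>z. matrix_inv (metric z))" by (auto simp: inv_metric_def metric_def g_inv_def)
  then show ?thesis using differentiable_matrix_inv[OF dif_metric invertible_metric] assms by simp
qed

lemma pd_metric:
  assumes "z \<in> S" shows "pd c i (\<lambda>y. g c y $ a $ b) (pt z) = D (E i) metric z $ a $ b"
proof -
  have d: "dif (\<lambda>z. metric z $ a) z" by (rule dif_nth[OF dif_metric[OF assms]])
  have "pd c i (\<lambda>y. g c y $ a $ b) (pt z) = D (E i) (\<lambda>z. metric z $ a $ b) z"
    using pd_eq_D[OF assms, of "\<lambda>_ y. g c y $ a $ b"] dif_nth[OF d] by (simp add: metric_def)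
  then show ?thesis by (simp add: D_nth[OF assms d] D_nth[OF assms dif_metric[OF assms]])
qed

lemma christoffel_eq:
  assumes "z \<in> S"
  shows "christoffel g c k i j (pt z) = (1/2) * (\<Sum>l\<in>UNIV. inv_metric z $ k $ l *
    (D (E i) metric z $ j $ l + D (E j) metric z $ i $ l - D (E l) metric z $ i $ j))"
  unfolding christoffel_def by (simp add: pd_metric[OF assms] inv_metric_def)

lemma christoffel_sym:
  assumes "z \<in> S"
  shows "christoffel g c k i j (pt z) = christoffel g c k j i (pt z)"
proof -
  have "D e metric z $ i $ j = D e metric z $ j $ i" for e
    using arg_cong[OF D_metric_sym[OF assms, of e], of "\<lambda>A. A $ j $ i"] by (simp add: transpose_def)
  then show ?thesis unfolding christoffel_eq[OF assms] by (simp add: add_ac)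
qed

lemma Gam_E: "Gam (E k) z $ a $ b = christoffel g c a k b (pt z)"
proof -
  have "(\<Sum>j\<in>UNIV. axis k (1::real) $ j * christoffel g c a j b (pt z)) 
     = (\<Sum>j\<in>UNIV. if j = k then christoffel g c a j b (pt z) else 0)"
    by (rule sum.cong) (auto simp: axis_def)
  then show ?thesis by (simp add: Gam_def)
qed

lemma Gam_time: "Gam (0, r) z = 0"
  by (simp add: Gam_def vec_eq_iff)

lemma linear_Gam: "linear (\<lambda>e. Gam e z)"
  by (intro linearI) (auto simp: Gam_def vec_eq_iff sum.distrib sum_distrib_left algebra_simps)

lemma torsion_free:
  assumes "z \<in> S" shows "Gam (X, r) z *v Y = Gam (Y, s) z *v X"
proof -
  have "(\<Sum>b\<in>UNIV. (\<Sum>k\<in>UNIV. X $ k * christoffel g c a k b (pt z)) * Y $ b)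
      = (\<Sum>b\<in>UNIV. (\<Sum>k\<in>UNIV. Y $ k * christoffel g c a k b (pt z)) * X $ b)" for a
    unfolding sum_distrib_right
    by (subst sum.swap) (simp add: christoffel_sym[OF assms, of a] mult_ac)
  then show ?thesis by (simp add: Gam_def vec_eq_iff matrix_vector_mult_def)
qed

lemma dif_Gam:
  assumes z: "z \<in> S" shows "dif (Gam e) z"
proof (intro differentiable_vec)
  fix a b
  have d: "dif (\<lambda>z. D (E i) metric z $ j $ l) z" for i j l
    by (intro dif_nth smooth_dif[OF smooth_D[OF smooth_metric_S]] z)
  have "dif (\<lambda>z. christoffel g c k i j (pt z)) z" for k i j
  proof (rule dif_cong[OF _ z])
    show "dif (\<lambda>z. (1/2) * (\<Sum>l\<in>UNIV. inv_metric z $ k $ l *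
      (D (E i) metric z $ j $ l + D (E j) metric z $ i $ l - D (E l) metric z $ i $ j))) z"
      by (intro differentiable_mult differentiable_sum differentiable_add differentiable_diff
           ballI d differentiable_const dif_nth dif_inv_metric z finite)
  qed (simp add: christoffel_eq)
  then show "dif (\<lambda>z. Gam e z $ a $ b) z"
    by (simp add: Gam_def)
qed

lemma D_time_metric: "z \<in> S \<Longrightarrow> D (0,1) metric z = 0"
  using D_time_static[of z "\<lambda>y. g c (cinv c y)"] dif_metric[of z] by (simp add: metric_def[abs_def])

lemma D_time_Gam: "z \<in> S \<Longrightarrow> D (0,1) (Gam e) z = 0"
  using D_time_static[of z "\<lambda>y. \<chi> a b. \<Sum>k\<in>UNIV. fst e $ k * christoffel g c a k b (cinv c y)"]
    dif_Gam[of z e] by (simp add: Gam_def[abs_def])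

text \<open>
  Both sides are linear in \<open>e\<close>. In time both vanish. For \<open>e = \<partial>\<^sub>k\<close>, lowering the upper index of the
  Christoffel symbol gives half of \<open>\<partial>\<^sub>k g\<^sub>b\<^sub>a + \<partial>\<^sub>b g\<^sub>k\<^sub>a - \<partial>\<^sub>a g\<^sub>k\<^sub>b\<close>, and symmetrising in \<open>a, b\<close> leaves
  \<open>\<partial>\<^sub>k g\<^sub>a\<^sub>b\<close>.
\<close>

lemma metric_compatible:
  assumes z: "z \<in> S"
  shows "D e metric z = transpose (Gam e z) ** metric z + metric z ** Gam e z"
proof (rule linear_eq_on_space_and_time[where f = "\<lambda>e. D e metric z"])
  show "linear (\<lambda>e. D e metric z)" by (rule linear_dird[OF dif_metric[OF z]])
  show "linear (\<lambda>e. transpose (Gam e z) ** metric z + metric z ** Gam e z)"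
    by (intro linearI) (simp_all add: linear_add[OF linear_Gam] linear_cmul[OF linear_Gam] transpose_add
       transpose_scalar mm.add_left mm.add_right mm.scaleR_left mm.scaleR_right scaleR_add_right)
  show "D (0,1) metric z = transpose (Gam (0,1) z) ** metric z + metric z ** Gam (0,1) z"
    by (simp add: D_time_metric[OF z] Gam_time mm.zero_right mm.zero_left linear_0[OF bounded_linear.linear[OF bounded_linear_transpose]])
  fix k
  have sym: "D e metric z $ i $ j = D e metric z $ j $ i" for e i j
    using arg_cong[OF D_metric_sym[OF z, of e], of "\<lambda>A. A $ j $ i"] by (simp add: transpose_def)
  have low: "(metric z ** Gam (E k) z) $ a $ b =
      (1/2) * (D (E k) metric z $ b $ a + D (E b) metric z $ k $ a - D (E a) metric z $ k $ b)" for a b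
  proof -
    let ?X = "\<chi> l. D (E k) metric z $ b $ l + D (E b) metric z $ k $ l - D (E l) metric z $ k $ b"
    have "(metric z ** Gam (E k) z) $ a $ b = (metric z *v ((1/2) *\<^sub>R (inv_metric z *v ?X))) $ a"
      by (simp add: matrix_matrix_mult_def Gam_E christoffel_eq[OF z] matrix_vector_mult_def mult_ac)
    also have "metric z *v ((1/2) *\<^sub>R (inv_metric z *v ?X)) = (1/2) *\<^sub>R ?X"
      by (simp add: mv.scaleR_right matrix_vector_mul_assoc metric_inv_metric[OF z])
    finally show ?thesis by simp
  qed
  have tr: "transpose (Gam (E k) z) ** metric z = transpose (metric z ** Gam (E k) z)"
    by (simp add: matrix_transpose_mul metric_S_sym[OF z])
  show "D (E k) metric z = transpose (Gam (E k) z) ** metric z + metric z ** Gam (E k) z"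
    unfolding tr vec_eq_iff
  proof (intro allI)
    fix a b
    have "(transpose (metric z ** Gam (E k) z) + metric z ** Gam (E k) z) $ a $ b
        = (metric z ** Gam (E k) z) $ b $ a + (metric z ** Gam (E k) z) $ a $ b"
      by (simp add: transpose_def)
    also have "\<dots> = D (E k) metric z $ a $ b"
      unfolding low using sym[of "E k" a b] sym[of "E a" k b] sym[of "E b" k a] by (simp add: field_simps)
    finally show "D (E k) metric z $ a $ b = (transpose (metric z ** Gam (E k) z) + metric z ** Gam (E k) z) $ a $ b" by simp
  qed
qed

lemma inverse_metric_compatible:
  assumes z: "z \<in> S"
  shows "D e inv_metric z = - (Gam e z ** inv_metric z + inv_metric z ** transpose (Gam e z))"
proof -
  have "D e (\<lambda>y. inv_metric y ** metric y) z = D e (\<lambda>y. mat 1) z"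
    by (rule dird_cong[OF inv_metric_metric z])
  then have "inv_metric z ** D e metric z + D e inv_metric z ** metric z = 0"
    by (simp add: D_mm[OF z dif_inv_metric[OF z] dif_metric[OF z]] D_const[OF z])
  then have "(inv_metric z ** D e metric z + D e inv_metric z ** metric z) ** inv_metric z = 0" by (simp add: mm.zero_left)
  then have "inv_metric z ** transpose (Gam e z) ** (metric z ** inv_metric z) + (inv_metric z ** metric z) ** Gam e z ** inv_metric z
     + D e inv_metric z ** (metric z ** inv_metric z) = 0"
    by (simp only: metric_compatible[OF z] mm.add_left mm.add_right matrix_mul_assoc)
  then have "inv_metric z ** transpose (Gam e z) + Gam e z ** inv_metric z + D e inv_metric z = 0"
    by (simp add: metric_inv_metric[OF z] inv_metric_metric[OF z])
  then show ?thesis by (metis add.commute add_eq_0_iff)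
qed

section \<open>Curvature\<close>

text \<open>
  The curvature of the connection matrices, as an endomorphism \<open>R(a,b)\<close>.
\<close>

definition curv :: "(real ^ 'n) \<times> real \<Rightarrow> (real ^ 'n) \<times> real \<Rightarrow> (real ^ 'n) \<times> real \<Rightarrow> real ^ 'n ^ 'n" where
  "curv a b z = D a (Gam b) z - D b (Gam a) z + Gam a z ** Gam b z - Gam b z ** Gam a z"

text \<open>
  The second derivatives of the metric commute. Expressing each of them twice through metric
  compatibility leaves \<open>R\<^sup>T G + G R = 0\<close> for the metric \<open>G\<close>; multiplication by the inverse metric on
  both sides gives the claim.
\<close>

lemma curvature_skew:
  assumes z: "z \<in> S"
  shows "curv a b z ** inv_metric z = - (inv_metric z ** transpose (curv a b z))"
proof -
  have DD: "D a (D b metric) z = transpose (D a (Gam b) z) ** metric z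
      + transpose (Gam b z) ** (transpose (Gam a z) ** metric z + metric z ** Gam a z)
      + (transpose (Gam a z) ** metric z + metric z ** Gam a z) ** Gam b z + metric z ** D a (Gam b) z" for a b
  proof -
    have "D a (D b metric) z = D a (\<lambda>y. transpose (Gam b y) ** metric y + metric y ** Gam b y) z"
      by (rule dird_cong[OF metric_compatible z])
    also have "\<dots> = D a (\<lambda>y. transpose (Gam b y) ** metric y) z + D a (\<lambda>y. metric y ** Gam b y) z"
      by (intro D_add z dif_mm dif_transpose dif_metric dif_Gam)
    also have "D a (\<lambda>y. transpose (Gam b y) ** metric y) z
        = transpose (Gam b z) ** D a metric z + transpose (D a (Gam b) z) ** metric z"
      by (subst D_mm[OF z dif_transpose[OF dif_Gam[OF z]] dif_metric[OF z]])
         (simp add: D_transpose[OF z dif_Gam[OF z]])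
    also have "D a (\<lambda>y. metric y ** Gam b y) z = metric z ** D a (Gam b) z + D a metric z ** Gam b z"
      by (rule D_mm[OF z dif_metric[OF z] dif_Gam[OF z]])
    finally show ?thesis
      unfolding metric_compatible[OF z, of a] by (simp only: add_ac)
  qed
  have "D a (D b metric) z = D b (D a metric) z"
    by (rule D_commute[OF smooth_metric_S z])
  then have "transpose (curv a b z) ** metric z + metric z ** curv a b z = 0"
    unfolding DD curv_def
    by (simp add: transpose_add transpose_diff matrix_transpose_mul mm.add_left mm.add_right mm.diff_left mm.diff_right
       matrix_mul_assoc algebra_simps)
  then have "inv_metric z ** (transpose (curv a b z) ** metric z + metric z ** curv a b z) ** inv_metric z = 0"
    by (simp add: mm.zero_left mm.zero_right)
  then have "inv_metric z ** transpose (curv a b z) ** (metric z ** inv_metric z) + (inv_metric z ** metric z) ** curv a b z ** inv_metric z = 0"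
    by (simp only: mm.add_left mm.add_right matrix_mul_assoc)
  then show ?thesis by (simp add: metric_inv_metric[OF z] inv_metric_metric[OF z] add_eq_0_iff)
qed

lemma linear_curv: assumes z: "z \<in> S" shows "linear (\<lambda>b. curv a b z)"
proof -
  have "D a (Gam (b + b')) z = D a (Gam b) z + D a (Gam b') z" for b b'
  proof -
    have "D a (Gam (b + b')) z = D a (\<lambda>y. Gam b y + Gam b' y) z"
      by (simp add: linear_add[OF linear_Gam, symmetric])
    also have "\<dots> = D a (Gam b) z + D a (Gam b') z" by (intro D_add z dif_Gam)
    finally show ?thesis .
  qed
  moreover have "D a (Gam (r *\<^sub>R b)) z = r *\<^sub>R D a (Gam b) z" for r b
  proof -
    have "D a (Gam (r *\<^sub>R b)) z = D a (\<lambda>y. r *\<^sub>R Gam b y) z"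
      by (simp add: linear_cmul[OF linear_Gam, symmetric])
    also have "\<dots> = r *\<^sub>R D a (Gam b) z"
      by (rule D_linear[OF z bounded_linear_scaleR_right dif_Gam[OF z]])
    finally show ?thesis .
  qed
  ultimately show ?thesis
    using linear_add[OF linear_dird[OF dif_Gam[OF z]]] linear_cmul[OF linear_dird[OF dif_Gam[OF z]]]
    by (intro linearI) (simp_all add: curv_def linear_add[OF linear_Gam] linear_cmul[OF linear_Gam]
       mm.add_left mm.add_right mm.scaleR_left mm.scaleR_right algebra_simps)
qed

lemma riemann_eq:
  assumes z: "z \<in> S"
  shows "riemann g c l k i j (pt z) = curv (E i) (E j) z $ l $ k"
proof -
  have pdG: "pd c i (christoffel g c l j k) (pt z) = D (E i) (Gam (E j)) z $ l $ k" for i j k l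
  proof -
    have d: "dif (\<lambda>z. Gam (E j) z $ l) z" by (rule dif_nth[OF dif_Gam[OF z]])
    have "pd c i (christoffel g c l j k) (pt z) = D (E i) (\<lambda>z. Gam (E j) z $ l $ k) z"
      using pd_eq_D[OF z, of "\<lambda>_. christoffel g c l j k"] dif_nth[OF d] by (simp add: Gam_E)
    then show ?thesis by (simp add: D_nth[OF z d] D_nth[OF z dif_Gam[OF z]])
  qed
  show ?thesis
    unfolding riemann_def pdG by (simp add: curv_def matrix_matrix_mult_def Gam_E sum_subtractf)
qed

lemma Ric_eq:
  assumes z: "z \<in> S"
  shows "Ric g c (pt z) Y Z = (\<Sum>i\<in>UNIV. (curv (E i) (Y, 0) z *v Z) $ i)"
proof (rule linear_eq_on_space[where f = "\<lambda>Y. Ric g c (pt z) Y Z"])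
  show "linear (\<lambda>Y. Ric g c (pt z) Y Z)"
    by (intro linearI) (simp_all add: Ric_def sum.distrib sum_distrib_left algebra_simps)
  show "linear (\<lambda>Y. \<Sum>i\<in>UNIV. (curv (E i) (Y, 0) z *v Z) $ i)"
  proof (rule linearI)
    show "(\<Sum>i\<in>UNIV. (curv (E i) (Y + Y', 0) z *v Z) $ i) =
        (\<Sum>i\<in>UNIV. (curv (E i) (Y, 0) z *v Z) $ i) + (\<Sum>i\<in>UNIV. (curv (E i) (Y', 0) z *v Z) $ i)" for Y Y'
      using linear_add[OF linear_curv[OF z], of _ "(Y,0)" "(Y',0)"]
      by (simp add: mv.add_left sum.distrib)
    show "(\<Sum>i\<in>UNIV. (curv (E i) (r *\<^sub>R Y, 0) z *v Z) $ i) =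
        r *\<^sub>R (\<Sum>i\<in>UNIV. (curv (E i) (Y, 0) z *v Z) $ i)" for r Y
      using linear_cmul[OF linear_curv[OF z], of _ r "(Y,0)"]
      by (simp add: mv.scaleR_left sum_distrib_left)
  qed
  fix j :: 'n
  have "Ric g c (pt z) (axis j 1) Z =
     (\<Sum>j'\<in>UNIV. if j' = j then \<Sum>k\<in>UNIV. (\<Sum>i\<in>UNIV. riemann g c i k i j (pt z)) * Z $ k else 0)"
    unfolding Ric_def by (rule sum.cong) (auto simp: axis_def)
  also have "\<dots> = (\<Sum>k\<in>UNIV. \<Sum>i\<in>UNIV. riemann g c i k i j (pt z) * Z $ k)"
    by (simp add: sum_distrib_right)
  also have "\<dots> = (\<Sum>i\<in>UNIV. \<Sum>k\<in>UNIV. riemann g c i k i j (pt z) * Z $ k)"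
    by (rule sum.swap)
  also have "\<dots> = (\<Sum>i\<in>UNIV. (curv (E i) (E j) z *v Z) $ i)"
    by (simp add: riemann_eq[OF z] matrix_vector_mult_def)
  finally show "Ric g c (pt z) (axis j 1) Z = (\<Sum>i\<in>UNIV. (curv (E i) (axis j 1, 0) z *v Z) $ i)" .
qed

section \<open>Covariant derivatives of one-forms and Hessians\<close>

definition cov :: "(real ^ 'n) \<times> real \<Rightarrow> ((real ^ 'n) \<times> real \<Rightarrow> real ^ 'n) \<Rightarrow> (real ^ 'n) \<times> real \<Rightarrow> real ^ 'n" where
  "cov e \<omega> z = D e \<omega> z - \<omega> z v* Gam e z"

lemma linear_cov: assumes "dif \<omega> z" shows "linear (\<lambda>e. cov e \<omega> z)"
  unfolding cov_def
  by (intro linearI) (simp_all add: linear_add[OF linear_dird[OF assms]] linear_cmul[OF linear_dird[OF assms]]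
     linear_add[OF linear_Gam] linear_cmul[OF linear_Gam] vm.add_right vm.scaleR_right algebra_simps)

lemma dif_cov: assumes "smooth_on S \<omega>" "z \<in> S" shows "dif (cov e \<omega>) z"
  unfolding cov_def[abs_def]
  by (intro differentiable_diff dif_vm smooth_dif[OF smooth_D] smooth_dif[OF assms(1)] dif_Gam assms)

text \<open>
  The Hessian is the covariant derivative of the differential. The differential is passed as a
  separate function \<open>\<omega>\<close> because for \<open>w\<close> it is known as an explicit expression whose
  differentiability can be read off.
\<close>

lemma hess_row:
  fixes \<phi> :: "real \<Rightarrow> 'a \<Rightarrow> real" and \<omega> :: "(real ^ 'n) \<times> real \<Rightarrow> real ^ 'n"
  assumes z: "z \<in> S" and d: "\<And>y. y \<in> S \<Longrightarrow> dif (\<lambda>z. \<phi> (snd z) (pt z)) y"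
    and \<omega>: "\<And>y j. y \<in> S \<Longrightarrow> D (E j) (\<lambda>z. \<phi> (snd z) (pt z)) y = \<omega> y $ j" and d\<omega>: "dif \<omega> z"
  shows "hess g c (\<phi> (snd z)) (pt z) $ i = cov (E i) \<omega> z"
proof -
  have pd1: "pd c j (\<phi> (snd y)) (pt y) = \<omega> y $ j" if "y \<in> S" for y j
    using pd_eq_D[OF that d[OF that]] \<omega>[OF that] by simp
  have pd2: "pd c i (pd c j (\<phi> (snd z))) (pt z) = D (E i) \<omega> z $ j" for j
  proof -
    have "dif (\<lambda>y. pd c j (\<phi> (snd y)) (pt y)) z"
      by (rule dif_cong[OF dif_nth[OF d\<omega>] z]) (simp add: pd1)
    then have "pd c i (pd c j (\<phi> (snd z))) (pt z) = D (E i) (\<lambda>y. pd c j (\<phi> (snd y)) (pt y)) z"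
      by (rule pd_eq_D[OF z, where \<phi> = "\<lambda>\<tau>. pd c j (\<phi> \<tau>)"])
    also have "\<dots> = D (E i) (\<lambda>y. \<omega> y $ j) z"
      by (rule dird_cong[OF pd1 z])
    also have "\<dots> = D (E i) \<omega> z $ j" by (rule D_nth[OF z d\<omega>])
    finally show ?thesis .
  qed
  show ?thesis
    by (simp add: vec_eq_iff hess_def pd2 pd1[OF z] cov_def vector_matrix_mult_def Gam_E mult.commute)
qed

end

section \<open>Derivatives of the solution up to third order\<close>

locale heat_solution = metric_chart c g T
  for c :: "('a, 'n::finite) chart" and g :: "('a, 'n) metric" and T :: real +
  fixes p \<epsilon> :: real and h :: "real \<Rightarrow> real" and v :: "real \<Rightarrow> 'a \<Rightarrow> real"
  assumes eps_pos: "0 < \<epsilon>"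
    and smooth_h: "smooth_on {0..} h"
    and smooth_v: "smooth_on S (\<lambda>z. v (snd z) (pt z))"
    and equation: "z \<in> S \<Longrightarrow> dt T v (snd z) (pt z)
      = L_eps g p \<epsilon> c (v (snd z)) (v (snd z)) (pt z) + h (grad_sq g c (v (snd z)) (pt z))"
begin

definition V :: "(real ^ 'n) \<times> real \<Rightarrow> real" where "V z = v (snd z) (pt z)"

definition dv :: "(real ^ 'n) \<times> real \<Rightarrow> real ^ 'n" where
  "dv z = (\<chi> i. D (E i) V z)"

definition grad_v :: "(real ^ 'n) \<times> real \<Rightarrow> real ^ 'n" where
  "grad_v z = grad g c (v (snd z)) (pt z)"

definition hess_v :: "(real ^ 'n) \<times> real \<Rightarrow> real ^ 'n ^ 'n" where
  "hess_v z = hess g c (v (snd z)) (pt z)"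

definition s :: "(real ^ 'n) \<times> real \<Rightarrow> real" where
  "s z = grad_sq g c (v (snd z)) (pt z)"

text \<open>
  The covariant derivative \<open>\<nabla>\<^sub>e \<nabla>\<^sup>2v\<close> in a spacetime direction \<open>e\<close>.
\<close>

definition cov_hess :: "(real ^ 'n) \<times> real \<Rightarrow> (real ^ 'n) \<times> real \<Rightarrow> real ^ 'n ^ 'n" where
  "cov_hess e z = D e hess_v z - transpose (Gam e z) ** hess_v z - hess_v z ** Gam e z"

lemma smooth_V: "smooth_on S V"
  using smooth_v by (simp add: V_def[abs_def])

lemma smooth_dv: "smooth_on S dv"
  by (rule smooth_on_vec) (simp add: dv_def smooth_D[OF smooth_V])

lemma dif_V: "z \<in> S \<Longrightarrow> dif V z" by (rule smooth_dif[OF smooth_V])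

lemma dif_dv: "z \<in> S \<Longrightarrow> dif dv z" by (rule smooth_dif[OF smooth_dv])

lemma pd_v: "z \<in> S \<Longrightarrow> pd c i (v (snd z)) (pt z) = dv z $ i"
  using pd_eq_D[of z v] dif_V[of z] by (simp add: V_def[abs_def] dv_def)

lemma grad_v_eq: "z \<in> S \<Longrightarrow> grad_v z = inv_metric z *v dv z"
  using grad_eq[OF pd_v] by (simp add: grad_v_def inv_metric_def)

lemma metric_grad_v: "z \<in> S \<Longrightarrow> metric z *v grad_v z = dv z"
  by (simp add: grad_v_eq matrix_vector_mul_assoc metric_inv_metric)

lemma s_eq: "z \<in> S \<Longrightarrow> s z = dv z \<bullet> grad_v z"
  using metric_grad_v[of z] by (simp add: s_def grad_sq_def g_inner_eq grad_v_def[symmetric] metric_def[symmetric] inner_commute)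

lemma s_nonneg: assumes "z \<in> S" shows "0 \<le> s z"
  using metric_pos[OF pt_in[OF assms], of "grad_v z"]
  by (cases "grad_v z = 0") (simp_all add: s_def grad_sq_def g_inner_eq grad_v_def[symmetric] less_imp_le)

lemma dif_grad_v: assumes "z \<in> S" shows "dif grad_v z"
  by (rule dif_cong[OF dif_mv[OF dif_inv_metric dif_dv]]) (simp_all add: assms grad_v_eq)

lemma dif_s: assumes "z \<in> S" shows "dif s z"
  by (rule dif_cong[OF dif_inner[OF dif_dv dif_grad_v]]) (simp_all add: assms s_eq)

abbreviation h1 :: "real \<Rightarrow> real" where "h1 \<equiv> deriv_within {0..} h"
abbreviation h2 :: "real \<Rightarrow> real" where "h2 \<equiv> deriv_within {0..} h1"

lemma D_h_s:
  assumes "z \<in> S"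
  shows "D e (\<lambda>y. h (s y)) z = h1 (s z) * D e s z" "dif (\<lambda>y. h (s y)) z"
    "D e (\<lambda>y. h1 (s y)) z = h2 (s z) * D e s z" "dif (\<lambda>y. h1 (s y)) z"
  using dird_compose_half_line[OF thick_S assms _ dif_s[OF assms] s_nonneg]
    smooth_h smooth_deriv_half_line[OF smooth_h] by blast+

lemma hess_v_row:
  assumes z: "z \<in> S" shows "hess_v z $ i = cov (E i) dv z"
  unfolding hess_v_def
proof (rule hess_row[OF z _ _ dif_dv[OF z]])
  show "dif (\<lambda>z. v (snd z) (pt z)) y" if "y \<in> S" for y
    using dif_V[OF that] by (simp add: V_def[abs_def])
  show "D (E j) (\<lambda>z. v (snd z) (pt z)) y = dv y $ j" for y j
    by (simp add: dv_def V_def[abs_def])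
qed

lemma D_dv_nth: "z \<in> S \<Longrightarrow> D e dv z $ i = D (E i) (D e V) z"
proof -
  assume z: "z \<in> S"
  have "D e dv z $ i = D e (\<lambda>y. dv y $ i) z" by (rule D_nth[symmetric, OF z dif_dv[OF z]])
  also have "\<dots> = D e (D (E i) V) z" by (simp add: dv_def)
  also have "\<dots> = D (E i) (D e V) z" by (rule D_commute[OF smooth_V z])
  finally show ?thesis .
qed

lemma hess_v_sym: assumes z: "z \<in> S" shows "transpose (hess_v z) = hess_v z"
proof -
  have "hess_v z $ i $ j = hess_v z $ j $ i" for i j
  proof -
    have "D (E i) dv z $ j = D (E j) dv z $ i"
      using D_dv_nth[OF z, of "E i" j] D_dv_nth[OF z, of "E j" i] D_commute[OF smooth_V z, of "E i" "E j"]
      by (simp add: D_nth[OF z dif_dv[OF z], symmetric])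
    then show ?thesis
      by (simp add: hess_v_row[OF z] cov_def vector_matrix_mult_def Gam_E christoffel_sym[OF z, of _ i j])
  qed
  then show ?thesis by (simp add: transpose_def vec_eq_iff)
qed

lemma hess_v_apply:
  assumes z: "z \<in> S" shows "hess_v z *v X = cov (X, 0) dv z"
proof (rule linear_eq_on_space[where f = "\<lambda>X. hess_v z *v X"])
  note lin = linear_cov[OF dif_dv[OF z]]
  show "linear ((*v) (hess_v z))" by (rule matrix_vector_mul_linear)
  show "linear (\<lambda>X. cov (X, 0) dv z)"
    using linear_add[OF lin, of "(_, 0)" "(_, 0)"] linear_cmul[OF lin, of _ "(_, 0)"]
    by (intro linearI) simp_all
  show "hess_v z *v axis i 1 = cov (axis i 1, 0) dv z" for i
    by (simp add: sym_matrix_axis[OF hess_v_sym[OF z]] hess_v_row[OF z])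
qed

lemma dif_hess_v: assumes z: "z \<in> S" shows "dif hess_v z"
proof (rule differentiable_vec)
  show "dif (\<lambda>z. hess_v z $ i) z" for i
    by (rule dif_cong[OF dif_cov[OF smooth_dv z] z]) (simp add: hess_v_row)
qed

lemma hess_v_inner:
  "z \<in> S \<Longrightarrow> x \<bullet> (hess_v z *v y) = (hess_v z *v x) \<bullet> y"
  using hess_v_sym[of z] transpose_matrix_vector[of "hess_v z" x] by (simp add: dot_lmul_matrix[symmetric])

lemma D_grad_v:
  assumes z: "z \<in> S"
  shows "D e grad_v z = inv_metric z *v cov e dv z - Gam e z *v grad_v z"
proof -
  have "D e grad_v z = D e (\<lambda>y. inv_metric y *v dv y) z" by (rule dird_cong[OF grad_v_eq z])
  also have "\<dots> = inv_metric z *v D e dv z + D e inv_metric z *v dv z"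
    by (rule D_mv[OF z dif_inv_metric[OF z] dif_dv[OF z]])
  also have "\<dots> = inv_metric z *v cov e dv z - Gam e z *v grad_v z"
    by (simp add: inverse_metric_compatible[OF z] cov_def mv.diff_left mv.minus_left mv.diff_right
        matrix_vector_mul_assoc[symmetric] grad_v_eq[OF z])
  finally show ?thesis .
qed

lemma D_s: assumes z: "z \<in> S" shows "D e s z = 2 * (grad_v z \<bullet> cov e dv z)"
proof -
  have "D e s z = D e (\<lambda>y. dv y \<bullet> grad_v y) z" by (rule dird_cong[OF s_eq z])
  also have "\<dots> = dv z \<bullet> D e grad_v z + D e dv z \<bullet> grad_v z"
    by (rule D_inner[OF z dif_dv[OF z] dif_grad_v[OF z]])
  also have "dv z \<bullet> D e grad_v z = grad_v z \<bullet> cov e dv z - (dv z v* Gam e z) \<bullet> grad_v z"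
    by (simp add: D_grad_v[OF z] inner_diff_right inv_metric_inner[OF z] grad_v_eq[OF z, symmetric] dot_lmul_matrix)
  also have "\<dots> + D e dv z \<bullet> grad_v z = 2 * (grad_v z \<bullet> cov e dv z)"
    by (simp add: cov_def inner_diff_right inner_commute)
  finally show ?thesis .
qed

lemma D_s_E:
  assumes z: "z \<in> S"
  shows "D (E i) s z = (2 *\<^sub>R (hess_v z *v grad_v z)) $ i"
  by (simp add: D_s[OF z] hess_v_row[OF z, symmetric] matrix_vector_mul_component inner_commute)

text \<open>
  Since \<open>ds = 2 \<nabla>\<^sup>2v(\<nabla>v)\<close>, this is the product rule for half of \<open>\<nabla>\<^sub>e ds\<close>; for \<open>e = \<partial>\<^sub>i\<close> it gives the
  rows of half the Hessian of \<open>s\<close>.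
\<close>

lemma cov_hess_grad:
  assumes z: "z \<in> S"
  shows "cov e (\<lambda>y. hess_v y *v grad_v y) z = cov_hess e z *v grad_v z + hess_v z *v (inv_metric z *v cov e dv z)"
proof -
  have "D e (\<lambda>y. hess_v y *v grad_v y) z = hess_v z *v D e grad_v z + D e hess_v z *v grad_v z"
    by (rule D_mv[OF z dif_hess_v[OF z] dif_grad_v[OF z]])
  then show ?thesis
    unfolding cov_def[of e "\<lambda>y. hess_v y *v grad_v y"]
    by (simp add: D_grad_v[OF z] cov_hess_def mv.diff_right mv.diff_left matrix_vector_mul_assoc[symmetric])
qed

lemma dif_hess_grad: "z \<in> S \<Longrightarrow> dif (\<lambda>y. hess_v y *v grad_v y) z"
  by (intro dif_mv dif_hess_v dif_grad_v)

lemma D_hess_grad_grad: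
  assumes z: "z \<in> S"
  shows "D e (\<lambda>y. grad_v y \<bullet> (hess_v y *v grad_v y)) z
    = 2 * ((hess_v z *v grad_v z) \<bullet> (inv_metric z *v cov e dv z)) + grad_v z \<bullet> (cov_hess e z *v grad_v z)"
proof -
  have "D e (\<lambda>y. grad_v y \<bullet> (hess_v y *v grad_v y)) z = grad_v z \<bullet> D e (\<lambda>y. hess_v y *v grad_v y) z + D e grad_v z \<bullet> (hess_v z *v grad_v z)"
    by (rule D_inner[OF z dif_grad_v[OF z] dif_hess_grad[OF z]])
  also have "D e (\<lambda>y. hess_v y *v grad_v y) z = cov e (\<lambda>y. hess_v y *v grad_v y) z + (hess_v z *v grad_v z) v* Gam e z"
    by (simp add: cov_def)
  also have "grad_v z \<bullet> \<dots> = grad_v z \<bullet> (cov_hess e z *v grad_v z) + (hess_v z *v grad_v z) \<bullet> (inv_metric z *v cov e dv z)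
       + (hess_v z *v grad_v z) \<bullet> (Gam e z *v grad_v z)"
    by (simp only: cov_hess_grad[OF z] inner_add_right hess_v_inner[OF z] dot_lmul_matrix
        inner_commute[of "grad_v z" "_ v* _"])
  finally show ?thesis
    by (simp add: D_grad_v[OF z] inner_diff_right inner_commute[of _ "hess_v z *v grad_v z"])
qed

text \<open>
  The derivative of the scalar \<open>g\<^sup>i\<^sup>j \<nabla>\<^sub>i\<^sub>jv\<close>: the connection terms of the inverse metric cancel those
  of the Hessian.
\<close>

lemma D_laplacian:
  assumes z: "z \<in> S" shows "D e (\<lambda>y. inv_metric y \<bullet> hess_v y) z = inv_metric z \<bullet> cov_hess e z"
proof -
  have "D e (\<lambda>y. inv_metric y \<bullet> hess_v y) z = inv_metric z \<bullet> D e hess_v z + D e inv_metric z \<bullet> hess_v z"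
    by (rule D_inner[OF z dif_inv_metric[OF z] dif_hess_v[OF z]])
  also have "D e hess_v z = cov_hess e z + transpose (Gam e z) ** hess_v z + hess_v z ** Gam e z"
    by (simp add: cov_hess_def)
  also have "inv_metric z \<bullet> \<dots> = inv_metric z \<bullet> cov_hess e z + (Gam e z ** inv_metric z) \<bullet> hess_v z + (inv_metric z ** transpose (Gam e z)) \<bullet> hess_v z"
    by (simp add: inner_add_right inner_matrix_mult_left[of _ "transpose _"] inner_matrix_mult_right[of _ "hess_v z"])
  finally show ?thesis
    by (simp add: inverse_metric_compatible[OF z] inner_diff_left inner_add_left)
qed

text \<open>
  For a constant vector \<open>Y\<close> the vector \<open>\<nabla>\<^sup>2v \<cdot> Y\<close> is \<open>D\<^sub>Y dv - dv \<Gamma>\<^sub>Y\<close>. Differentiating along \<open>X\<close> and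
  exchanging the roles of \<open>X\<close> and \<open>Y\<close>, the second derivatives of \<open>dv\<close> cancel because they commute,
  the terms \<open>\<nabla>\<^sup>2v \<cdot> \<Gamma>\<^sub>X Y\<close> cancel because the connection is torsion free, and the rest is curvature.
\<close>

lemma ricci_identity:
  assumes z: "z \<in> S"
  shows "cov_hess (X, 0) z *v Y - cov_hess (Y, 0) z *v X = - (dv z v* curv (X, 0) (Y, 0) z)"
proof -
  have TT: "cov_hess (X, 0) z *v Y = D (X,0) (D (Y,0) dv) z - (dv z v* D (X,0) (Gam (Y,0)) z + D (X,0) dv z v* Gam (Y,0) z)
     - (hess_v z *v Y) v* Gam (X,0) z - hess_v z *v (Gam (X,0) z *v Y)" for X Y
  proof -
    have "D (X,0) hess_v z *v Y = D (X,0) (\<lambda>y. hess_v y *v Y) z"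
      by (rule D_linear[OF z _ dif_hess_v[OF z], symmetric]) (rule mv.bounded_linear_left)
    also have "\<dots> = D (X,0) (\<lambda>y. D (Y,0) dv y - dv y v* Gam (Y,0) y) z"
      by (rule dird_cong[OF _ z]) (simp add: hess_v_apply cov_def)
    also have "\<dots> = D (X,0) (D (Y,0) dv) z - D (X,0) (\<lambda>y. dv y v* Gam (Y,0) y) z"
      by (intro D_diff z smooth_dif[OF smooth_D[OF smooth_dv]] dif_vm dif_dv dif_Gam)
    also have "D (X,0) (\<lambda>y. dv y v* Gam (Y,0) y) z = dv z v* D (X,0) (Gam (Y,0)) z + D (X,0) dv z v* Gam (Y,0) z"
      by (rule D_vm[OF z dif_dv[OF z] dif_Gam[OF z]])
    finally show ?thesis
      by (simp add: cov_hess_def mv.diff_left matrix_vector_mul_assoc[symmetric])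
  qed
  show ?thesis
    unfolding TT[of X Y] TT[of Y X] torsion_free[OF z, of X 0 Y 0] D_commute[OF smooth_dv z, of "(X,0)"]
    by (simp add: hess_v_apply[OF z] cov_def curv_def vm.diff_left vm.add_right vm.diff_right
       vector_matrix_mul_assoc algebra_simps)
qed

lemma cov_hess_sym: assumes z: "z \<in> S" shows "transpose (cov_hess e z) = cov_hess e z"
proof -
  have "transpose (D e hess_v z) = D e (\<lambda>y. transpose (hess_v y)) z"
    by (rule D_transpose[symmetric, OF z dif_hess_v[OF z]])
  also have "\<dots> = D e hess_v z" by (rule dird_cong[OF hess_v_sym z])
  finally show ?thesis
    by (simp add: cov_hess_def transpose_diff matrix_transpose_mul hess_v_sym[OF z])
qed

lemma linear_cov_hess: assumes "z \<in> S" shows "linear (\<lambda>e. cov_hess e z)"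
  unfolding cov_hess_def
  by (intro linearI) (simp_all add: linear_add[OF linear_Gam] linear_cmul[OF linear_Gam]
    linear_add[OF linear_dird[OF dif_hess_v[OF assms]]] linear_cmul[OF linear_dird[OF dif_hess_v[OF assms]]] transpose_add
    transpose_scalar mm.add_left mm.add_right mm.scaleR_left mm.scaleR_right algebra_simps)

section \<open>The elliptic operator\<close>

definition sig :: "(real ^ 'n) \<times> real \<Rightarrow> real" where
  "sig z = s z + \<epsilon>\<^sup>2"

text \<open>
  Contraction with the coefficients \<open>a\<^sup>i\<^sup>j\<close> of the operator. The rank-one part is kept separate because it
  is differentiated and commuted differently from the trace part.
\<close>

definition a_trace :: "(real ^ 'n) \<times> real \<Rightarrow> real ^ 'n ^ 'n \<Rightarrow> real" where
  "a_trace z M = inv_metric z \<bullet> M + (p - 2) * ((grad_v z \<bullet> (M *v grad_v z)) / sig z)"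

lemma sig_pos: "z \<in> S \<Longrightarrow> 0 < sig z"
  using s_nonneg[of z] eps_pos by (simp add: sig_def add_nonneg_pos)

lemma sigma_eq: "sigma g \<epsilon> c (v (snd z)) (pt z) = sig z"
  by (simp add: sigma_def sig_def s_def)

lemma a_eps_contract:
  "(\<Sum>i\<in>UNIV. \<Sum>j\<in>UNIV. a_eps g p \<epsilon> c (v (snd z)) (pt z) $ i $ j * M $ i $ j) = a_trace z M"
proof -
  have "grad_v z \<bullet> (M *v grad_v z) = (\<Sum>i\<in>UNIV. \<Sum>j\<in>UNIV. grad_v z $ i * grad_v z $ j * M $ i $ j)"
    by (simp add: inner_vec_def matrix_vector_mult_def sum_distrib_left mult_ac)
  moreover have "inv_metric z \<bullet> M = (\<Sum>i\<in>UNIV. \<Sum>j\<in>UNIV. inv_metric z $ i $ j * M $ i $ j)"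
    by (simp add: inner_vec_def)
  ultimately show ?thesis
    by (simp only: a_trace_def a_eps_def sigma_eq grad_v_def[symmetric] inv_metric_def[symmetric] vec_lambda_beta
        distrib_right sum.distrib sum_distrib_left sum_divide_distrib times_divide_eq_left times_divide_eq_right mult.assoc)
qed

lemma L_eps_eq:
  "L_eps g p \<epsilon> c (v (snd z)) \<phi> (pt z) = a_trace z (hess g c \<phi> (pt z))"
  unfolding L_eps_def by (rule a_eps_contract)

lemma hess_endo_eq: "hess_endo g c (v (snd z)) (pt z) X = inv_metric z *v (hess_v z *v X)"
  by (simp add: hess_endo_def inv_metric_def hess_v_def matrix_vector_mult_def vec_eq_iff sum_distrib_left mult_ac)

lemma hess_form_eq: "hess_form g c (v (snd z)) (pt z) X Y = X \<bullet> (hess_v z *v Y)"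
  by (simp add: hess_form_def hess_v_def matrix_vector_mult_def inner_vec_def sum_distrib_left mult_ac)

definition A :: "(real ^ 'n) \<times> real \<Rightarrow> real ^ 'n" where
  "A z = A_eps g p \<epsilon> h c (v (snd z)) (pt z)"

lemma A_eq: "A z = h1 (s z) *\<^sub>R grad_v z + (p - 2) *\<^sub>R
   ((1 / sig z) *\<^sub>R (inv_metric z *v (hess_v z *v grad_v z)) - ((grad_v z \<bullet> (hess_v z *v grad_v z)) / (sig z)\<^sup>2) *\<^sub>R grad_v z)"
  by (simp add: A_def A_eps_def B_eps_def hess_endo_eq hess_form_eq sigma_eq grad_v_def[symmetric] s_def[symmetric])

lemma a_trace_add: "a_trace z (M + N) = a_trace z M + a_trace z N"
  by (simp add: a_trace_def inner_add_right mv.add_left add_divide_distrib algebra_simps)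

lemma a_trace_scaleR: "a_trace z (r *\<^sub>R M) = r * a_trace z M"
  by (simp add: a_trace_def mv.scaleR_left algebra_simps)

section \<open>Differentiating the equation\<close>

definition vt :: "(real ^ 'n) \<times> real \<Rightarrow> real" where
  "vt z = dt T v (snd z) (pt z)"

lemma vt_eq_D: "z \<in> S \<Longrightarrow> vt z = D (0,1) V z"
  using dt_eq_D[of z v] dif_V[of z] by (simp add: vt_def V_def[abs_def])

lemma smooth_vt: "smooth_on S vt"
  by (rule smooth_on_cong[OF smooth_D[OF smooth_V]]) (rule vt_eq_D[symmetric])

lemma dif_vt: "z \<in> S \<Longrightarrow> dif vt z" by (rule smooth_dif[OF smooth_vt])

lemma vt_eq: "z \<in> S \<Longrightarrow> vt z = a_trace z (hess_v z) + h (s z)"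
  using equation[of z] by (simp add: vt_def L_eps_eq hess_v_def s_def)

text \<open>
  The equation differentiated in an arbitrary spacetime direction. The first summand comes from
  the second derivatives of \<open>v\<close>; the derivatives of the coefficients and of \<open>h(s)\<close> both depend on
  \<open>e\<close> through \<open>\<nabla>\<^sub>e dv\<close> alone, and collecting them is what produces the vector \<open>A\<close>.
\<close>

lemma D_vt:
  assumes z: "z \<in> S"
  shows "D e vt z = a_trace z (cov_hess e z) + 2 * (cov e dv z \<bullet> A z)"
proof -
  have sg0: "sig z \<noteq> 0" using sig_pos[OF z] by simp
  have dsg: "dif sig z"
    unfolding sig_def[abs_def] by (intro differentiable_add differentiable_const dif_s z)
  have Dsg: "D e sig z = D e s z"
  proof -
    have "D e sig z = D e s z + D e (\<lambda>y. \<epsilon>\<^sup>2) z"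
      unfolding sig_def[abs_def] by (intro D_add z dif_s differentiable_const)
    then show ?thesis by (simp add: D_const[OF z])
  qed
  have d1: "dif (\<lambda>y. inv_metric y \<bullet> hess_v y) z" by (intro dif_inner dif_inv_metric dif_hess_v z)
  have d2: "dif (\<lambda>y. grad_v y \<bullet> (hess_v y *v grad_v y)) z" by (intro dif_inner dif_grad_v dif_hess_grad z)
  have d3: "dif (\<lambda>y. (grad_v y \<bullet> (hess_v y *v grad_v y)) / sig y) z" by (intro differentiable_divide d2 dsg sg0)
  have d4: "dif (\<lambda>y. (p - 2) * ((grad_v y \<bullet> (hess_v y *v grad_v y)) / sig y)) z"
    by (intro differentiable_mult differentiable_const d3)
  have "D e vt z = D e (\<lambda>y. (inv_metric y \<bullet> hess_v y + (p - 2) * ((grad_v y \<bullet> (hess_v y *v grad_v y)) / sig y)) + h (s y)) z"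
    by (rule dird_cong[OF _ z]) (simp add: vt_eq a_trace_def)
  also have "\<dots> = D e (\<lambda>y. inv_metric y \<bullet> hess_v y + (p - 2) * ((grad_v y \<bullet> (hess_v y *v grad_v y)) / sig y)) z
      + D e (\<lambda>y. h (s y)) z"
    by (intro D_add z differentiable_add d1 d4 D_h_s)
  also have "D e (\<lambda>y. inv_metric y \<bullet> hess_v y + (p - 2) * ((grad_v y \<bullet> (hess_v y *v grad_v y)) / sig y)) z
      = D e (\<lambda>y. inv_metric y \<bullet> hess_v y) z + D e (\<lambda>y. (p - 2) * ((grad_v y \<bullet> (hess_v y *v grad_v y)) / sig y)) z"
    by (intro D_add z d1 d4)
  also have "D e (\<lambda>y. (p - 2) * ((grad_v y \<bullet> (hess_v y *v grad_v y)) / sig y)) z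
      = (p - 2) * D e (\<lambda>y. (grad_v y \<bullet> (hess_v y *v grad_v y)) / sig y) z"
    by (rule D_linear[OF z bounded_linear_mult_right d3])
  also have "D e (\<lambda>y. (grad_v y \<bullet> (hess_v y *v grad_v y)) / sig y) z
     = (D e (\<lambda>y. grad_v y \<bullet> (hess_v y *v grad_v y)) z * sig z - (grad_v z \<bullet> (hess_v z *v grad_v z)) * D e sig z) / (sig z * sig z)"
    by (rule dird_divide[OF thick_S z d2 dsg sg0])
  finally have DW: "D e vt z = inv_metric z \<bullet> cov_hess e z + (p - 2) *
      (((2 * ((hess_v z *v grad_v z) \<bullet> (inv_metric z *v cov e dv z)) + grad_v z \<bullet> (cov_hess e z *v grad_v z)) * sig z
        - (grad_v z \<bullet> (hess_v z *v grad_v z)) * (2 * (grad_v z \<bullet> cov e dv z))) / (sig z * sig z))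
      + h1 (s z) * (2 * (grad_v z \<bullet> cov e dv z))"
    by (simp only: Dsg D_s[OF z] D_hess_grad_grad[OF z] D_laplacian[OF z] D_h_s(1)[OF z])
  have "cov e dv z \<bullet> (inv_metric z *v (hess_v z *v grad_v z)) = (hess_v z *v grad_v z) \<bullet> (inv_metric z *v cov e dv z)"
    unfolding inv_metric_inner[OF z, of "cov e dv z"] by (rule inner_commute)
  then have A': "cov e dv z \<bullet> A z = h1 (s z) * (grad_v z \<bullet> cov e dv z) + (p - 2) *
      ((1 / sig z) * ((hess_v z *v grad_v z) \<bullet> (inv_metric z *v cov e dv z))
       - (grad_v z \<bullet> (hess_v z *v grad_v z)) / (sig z)\<^sup>2 * (grad_v z \<bullet> cov e dv z))"
    by (simp only: A_eq inner_add_right inner_diff_right inner_scaleR_right inner_commute[of _ "grad_v z"])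
  \<comment> \<open>The quotient rule term is split into the parts that go into the two summands of the claim.\<close>
  have alg: "a + r * (((2 * b + d) * \<sigma> - k * (2 * n)) / (\<sigma> * \<sigma>)) + h' * (2 * n)
      = a + r * (d / \<sigma>) + 2 * (h' * n + r * ((1 / \<sigma>) * b - k / \<sigma>\<^sup>2 * n))"
    if "\<sigma> \<noteq> 0" for a r b d \<sigma> k n h' :: real
    using that by (simp add: field_simps power2_eq_square)
  show ?thesis unfolding DW A' a_trace_def by (rule alg[OF sg0])
qed

definition dvt :: "(real ^ 'n) \<times> real \<Rightarrow> real ^ 'n" where
  "dvt z = D (0,1) dv z"

lemma dvt_nth: assumes z: "z \<in> S" shows "dvt z $ i = D (E i) vt z"
proof -
  have "D (E i) vt z = D (E i) (D (0,1) V) z" by (rule dird_cong[OF vt_eq_D z])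
  then show ?thesis by (simp add: dvt_def D_dv_nth[OF z])
qed

lemma smooth_dvt: "smooth_on S dvt"
  unfolding dvt_def[abs_def] by (rule smooth_D[OF smooth_dv])

lemma dif_dvt: "z \<in> S \<Longrightarrow> dif dvt z" by (rule smooth_dif[OF smooth_dvt])

lemma cov_dv_time: "cov (0,1) dv z = dvt z"
  by (simp add: cov_def dvt_def Gam_time)

text \<open>
  The connection is static, so \<open>\<partial>\<^sub>t\<close> of the Hessian of \<open>v\<close> is the Hessian of \<open>v\<^sub>t\<close>.
\<close>

lemma cov_hess_time: assumes z: "z \<in> S" shows "cov_hess (0,1) z $ i = cov (E i) dvt z"
proof -
  have "cov_hess (0,1) z $ i = D (0,1) hess_v z $ i"
    by (simp add: cov_hess_def Gam_time linear_0[OF bounded_linear.linear[OF bounded_linear_transpose]])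
  also have "\<dots> = D (0,1) (\<lambda>y. hess_v y $ i) z"
    by (rule D_nth[symmetric, OF z dif_hess_v[OF z]])
  also have "\<dots> = D (0,1) (\<lambda>y. D (E i) dv y - dv y v* Gam (E i) y) z"
    by (rule dird_cong[OF _ z]) (simp add: hess_v_row cov_def)
  also have "\<dots> = D (0,1) (D (E i) dv) z - D (0,1) (\<lambda>y. dv y v* Gam (E i) y) z"
    by (intro D_diff z smooth_dif[OF smooth_D[OF smooth_dv]] dif_vm dif_dv dif_Gam)
  also have "D (0,1) (\<lambda>y. dv y v* Gam (E i) y) z = dv z v* D (0,1) (Gam (E i)) z + dvt z v* Gam (E i) z"
    unfolding dvt_def by (rule D_vm[OF z dif_dv[OF z] dif_Gam[OF z]])
  also have "D (0,1) (D (E i) dv) z = D (E i) dvt z"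
    unfolding dvt_def by (rule D_commute[OF smooth_dv z])
  finally show ?thesis by (simp add: cov_def D_time_Gam[OF z])
qed

lemma D_vt_space:
  assumes z: "z \<in> S" shows "D (X, 0) vt z = X \<bullet> dvt z"
proof (rule linear_eq_on_space[where f = "\<lambda>X. D (X, 0) vt z"])
  note lin = linear_dird[OF dif_vt[OF z]]
  show "linear (\<lambda>X. D (X, 0) vt z)"
    using linear_add[OF lin, of "(_, 0)" "(_, 0)"] linear_cmul[OF lin, of _ "(_, 0)"]
    by (intro linearI) simp_all
  show "linear (\<lambda>X. X \<bullet> dvt z)" by (intro linearI) (simp_all add: inner_add_left)
  show "D (E i) vt z = axis i 1 \<bullet> dvt z" for i
    by (simp add: inner_axis' dvt_nth[OF z])
qed

text \<open>
  By \<open>cov_hess_time\<close> the contraction on the right is \<open>L v\<^sub>t\<close>, so this is the linearised equation.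
\<close>

lemma vt_evolution:
  assumes z: "z \<in> S"
  shows "D (0,1) vt z = a_trace z (cov_hess (0,1) z) + 2 * (dvt z \<bullet> A z)"
  using D_vt[OF z, of "(0,1)"] by (simp add: cov_dv_time)

text \<open>
  The differentiated equation in the direction \<open>\<nabla>v\<close>. The left-hand side is \<open>s\<^sub>t / 2\<close>, so this
  trades the third derivatives of \<open>v\<close> in the Hessian of \<open>s\<close> for \<open>s\<^sub>t\<close> and \<open>\<langle>\<nabla>s, A\<rangle>\<close>.
\<close>

lemma vt_along_gradient:
  assumes z: "z \<in> S"
  shows "grad_v z \<bullet> dvt z = a_trace z (cov_hess (grad_v z, 0) z) + 2 * ((hess_v z *v grad_v z) \<bullet> A z)"
  using D_vt[OF z, of "(grad_v z,0)"] by (simp add: D_vt_space[OF z] hess_v_apply[OF z])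

section \<open>The Hessian of the squared gradient\<close>

text \<open>
  This matrix and the next are the two parts of half the Hessian of \<open>s\<close>, of third and of second order
  in \<open>v\<close>.
\<close>

definition hess_s_third :: "(real ^ 'n) \<times> real \<Rightarrow> real ^ 'n ^ 'n" where
  "hess_s_third z = (\<chi> i. cov_hess (E i) z *v grad_v z)"

definition hess_s_square :: "(real ^ 'n) \<times> real \<Rightarrow> real ^ 'n ^ 'n" where
  "hess_s_square z = hess_v z ** (inv_metric z ** hess_v z)"

lemma hess_s_square_row:
  assumes z: "z \<in> S"
  shows "hess_s_square z $ i = hess_v z *v (inv_metric z *v hess_v z $ i)"
proof -
  have "transpose (hess_s_square z) = hess_s_square z"
    by (simp add: hess_s_square_def matrix_transpose_mul hess_v_sym[OF z] inv_metric_sym[OF z] matrix_mul_assoc)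
  from sym_matrix_axis[OF this, of i] show ?thesis
    by (simp add: hess_s_square_def matrix_vector_mul_assoc[symmetric] sym_matrix_axis[OF hess_v_sym[OF z]])
qed

lemma a_trace_hess_s_square:
  assumes z: "z \<in> S" shows "a_trace z (hess_s_square z) = Q_eps g p \<epsilon> c (v (snd z)) (pt z)"
proof -
  have Hs: "hess_v z $ i $ j = hess_v z $ j $ i" for i j
    using arg_cong[OF hess_v_sym[OF z], of "\<lambda>A. A $ j $ i"] by (simp add: transpose_def)
  have "inv_metric z \<bullet> hess_s_square z = (\<Sum>i\<in>UNIV. \<Sum>k\<in>UNIV. \<Sum>j\<in>UNIV. \<Sum>l\<in>UNIV. inv_metric z $ i $ k * (hess_v z $ i $ j * (inv_metric z $ j $ l * hess_v z $ l $ k)))"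
    by (simp add: inner_vec_def hess_s_square_def matrix_matrix_mult_def sum_distrib_left)
  also have "\<dots> = (\<Sum>i\<in>UNIV. \<Sum>j\<in>UNIV. \<Sum>k\<in>UNIV. \<Sum>l\<in>UNIV. inv_metric z $ i $ k * (hess_v z $ i $ j * (inv_metric z $ j $ l * hess_v z $ l $ k)))"
    by (rule sum.cong[OF refl], rule sum.swap)
  also have "\<dots> = hess_HS_sq g c (v (snd z)) (pt z)"
    unfolding hess_HS_sq_def hess_v_def[symmetric] inv_metric_def[symmetric]
    by (intro sum.cong refl) (simp add: Hs[of _ _] mult_ac)
  finally have 1: "inv_metric z \<bullet> hess_s_square z = hess_HS_sq g c (v (snd z)) (pt z)" .
  let ?X = "inv_metric z *v (hess_v z *v grad_v z)"
  have "g_inner g c (pt z) ?X ?X = ?X \<bullet> (hess_v z *v grad_v z)"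
    by (simp add: g_inner_eq metric_def[symmetric] matrix_vector_mul_assoc metric_inv_metric[OF z] matrix_mul_assoc)
  also have "\<dots> = grad_v z \<bullet> (hess_s_square z *v grad_v z)"
    unfolding hess_s_square_def matrix_vector_mul_assoc[symmetric] hess_v_inner[OF z, of "grad_v z"] by (rule inner_commute)
  finally have "g_inner g c (pt z) ?X ?X = grad_v z \<bullet> (hess_s_square z *v grad_v z)" .
  with 1 show ?thesis
    by (simp add: Q_eps_def Let_def hess_endo_eq grad_v_def[symmetric] sigma_eq a_trace_def)
qed

text \<open>
  Bochner's argument: the Ricci identity moves the derivative along \<open>\<nabla>v\<close> to the front. In the trace
  with \<open>g\<^sup>i\<^sup>j\<close> the curvature term becomes the Ricci term by skewness. In the rank-one part the
  first index is contracted with \<open>\<nabla>v\<close>, which is the derivative along \<open>\<nabla>v\<close> itself.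
\<close>

lemma a_trace_hess_s_third:
  assumes z: "z \<in> S"
  shows "a_trace z (hess_s_third z) = a_trace z (cov_hess (grad_v z, 0) z) + Ric g c (pt z) (grad_v z) (grad_v z)"
proof -
  have "X v* hess_s_third z = cov_hess (X, 0) z *v grad_v z" for X
  proof (rule linear_eq_on_space[where f = "\<lambda>X. X v* hess_s_third z"])
    note lin = linear_cov_hess[OF z]
    show "linear (\<lambda>X. X v* hess_s_third z)" by (rule bounded_linear.linear[OF vm.bounded_linear_left])
    show "linear (\<lambda>X. cov_hess (X, 0) z *v grad_v z)"
      using linear_add[OF lin, of "(_, 0)" "(_, 0)"] linear_cmul[OF lin, of _ "(_, 0)"]
      by (intro linearI) (simp_all add: mv.add_left mv.scaleR_left)
    show "axis i 1 v* hess_s_third z = cov_hess (axis i 1, 0) z *v grad_v z" for i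
      by (simp add: axis_vector_matrix hess_s_third_def)
  qed
  then have 1: "grad_v z \<bullet> (hess_s_third z *v grad_v z) = grad_v z \<bullet> (cov_hess (grad_v z, 0) z *v grad_v z)"
    by (simp add: dot_lmul_matrix[symmetric] inner_commute)
  have R: "(dv z v* curv (E i) (grad_v z, 0) z) \<bullet> inv_metric z $ i = - ((curv (E i) (grad_v z, 0) z *v grad_v z) $ i)" for i
  proof -
    let ?R = "curv (E i) (grad_v z, 0) z"
    have "(dv z v* ?R) \<bullet> inv_metric z $ i = dv z \<bullet> ((?R ** inv_metric z) *v axis i 1)"
      by (simp only: dot_lmul_matrix sym_matrix_axis[OF inv_metric_sym[OF z], symmetric] matrix_vector_mul_assoc)
    also have "\<dots> = - (dv z \<bullet> (inv_metric z *v (axis i 1 v* ?R)))"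
      by (simp only: curvature_skew[OF z] mv.minus_left matrix_vector_mul_assoc[symmetric] inner_minus_right transpose_matrix_vector)
    also have "\<dots> = - ((axis i 1 v* ?R) \<bullet> grad_v z)"
      by (simp add: inv_metric_inner[OF z] grad_v_eq[OF z] inner_commute)
    also have "\<dots> = - ((?R *v grad_v z) $ i)"
      by (simp add: axis_vector_matrix matrix_vector_mul_component)
    finally show ?thesis .
  qed
  have row: "hess_s_third z $ i = cov_hess (grad_v z, 0) z $ i - dv z v* curv (E i) (grad_v z, 0) z" for i
    using ricci_identity[OF z, of "axis i 1" "grad_v z"] sym_matrix_axis[OF cov_hess_sym[OF z], of "(grad_v z, 0)" i]
    by (simp add: hess_s_third_def algebra_simps)
  have "inv_metric z \<bullet> hess_s_third z = (\<Sum>i\<in>UNIV. inv_metric z $ i \<bullet> hess_s_third z $ i)" by (simp add: inner_vec_def)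
  also have "\<dots> = (\<Sum>i\<in>UNIV. inv_metric z $ i \<bullet> cov_hess (grad_v z, 0) z $ i) + (\<Sum>i\<in>UNIV. (curv (E i) (grad_v z, 0) z *v grad_v z) $ i)"
    by (simp add: row inner_diff_right inner_commute[of "inv_metric z $ _" "_ v* _"] R sum.distrib)
  also have "\<dots> = inv_metric z \<bullet> cov_hess (grad_v z, 0) z + Ric g c (pt z) (grad_v z) (grad_v z)"
    by (simp add: Ric_eq[OF z]) (simp add: inner_vec_def)
  finally show ?thesis by (simp add: a_trace_def 1)
qed

lemma cov_hess_grad_row:
  "z \<in> S \<Longrightarrow> cov (E i) (\<lambda>y. hess_v y *v grad_v y) z = (hess_s_third z + hess_s_square z) $ i"
  by (simp add: cov_hess_grad hess_s_third_def hess_s_square_row hess_v_row)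

section \<open>The evolution of w\<close>

text \<open>
  By linearity and the chain rule, \<open>L w - w\<^sub>t\<close> is \<open>h'(s) (L s - s\<^sub>t) + h''(s) a\<^sup>i\<^sup>j s\<^sub>i s\<^sub>j\<close> minus \<open>\<alpha>\<close> times
  \<open>L v\<^sub>t - v\<^sub>t\<^sub>t\<close>. The third derivatives in \<open>L s\<close> cancel against \<open>s\<^sub>t\<close> by \<open>vt_along_gradient\<close>, and what is left
  of both parts is the transport term \<open>-2\<langle>\<nabla>w, A\<rangle>\<close>.
\<close>

theorem evolution_of_w:
  assumes z: "z \<in> S"
  shows "L_eps g p \<epsilon> c (v (snd z)) (w_alpha g h T \<alpha> c v (snd z)) (pt z) - dt T (w_alpha g h T \<alpha> c v) (snd z) (pt z) =
     2 * h1 (s z) * (Q_eps g p \<epsilon> c (v (snd z)) (pt z) + Ric g c (pt z) (grad_v z) (grad_v z))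
     + h2 (s z) * (\<Sum>i\<in>UNIV. \<Sum>j\<in>UNIV. a_eps g p \<epsilon> c (v (snd z)) (pt z) $ i $ j
          * pd c i (grad_sq g c (v (snd z))) (pt z) * pd c j (grad_sq g c (v (snd z))) (pt z))
     - 2 * g_inner g c (pt z) (grad g c (w_alpha g h T \<alpha> c v (snd z)) (pt z)) (A z)"
proof -
  let ?w = "w_alpha g h T \<alpha> c v"
  \<comment> \<open>The differentials of \<open>s\<close> and \<open>w\<close> on all of \<open>S\<close>, as needed to differentiate once more.\<close>
  define ds where "ds y = 2 *\<^sub>R (hess_v y *v grad_v y)" for y
  define dw where "dw y = h1 (s y) *\<^sub>R ds y - \<alpha> *\<^sub>R dvt y" for y
  have w: "(\<lambda>y. ?w (snd y) (pt y)) = (\<lambda>y. h (s y) - \<alpha> * vt y)"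
    by (simp add: w_alpha_def s_def vt_def)
  have daW: "dif (\<lambda>y. \<alpha> * vt y) y" if "y \<in> S" for y
    by (intro differentiable_mult differentiable_const dif_vt that)
  have dw: "dif (\<lambda>y. ?w (snd y) (pt y)) y" if "y \<in> S" for y
    unfolding w by (intro differentiable_diff D_h_s daW that)
  have Dw: "D e (\<lambda>y. ?w (snd y) (pt y)) y = h1 (s y) * D e s y - \<alpha> * D e vt y" if "y \<in> S" for e y
  proof -
    have "D e (\<lambda>y. h (s y) - \<alpha> * vt y) y = D e (\<lambda>y. h (s y)) y - D e (\<lambda>y. \<alpha> * vt y) y"
      by (intro D_diff D_h_s daW that)
    also have "D e (\<lambda>y. \<alpha> * vt y) y = \<alpha> * D e vt y"
      by (rule D_linear[OF that bounded_linear_mult_right dif_vt[OF that]])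
    finally show ?thesis by (simp add: w D_h_s[OF that])
  qed
  have DwE: "D (E i) (\<lambda>y. ?w (snd y) (pt y)) y = dw y $ i" if "y \<in> S" for i y
    by (simp add: Dw[OF that] D_s_E[OF that] dvt_nth[OF that] dw_def ds_def)
  have d_ds: "dif ds z"
    unfolding ds_def[abs_def] by (intro differentiable_scaleR differentiable_const dif_hess_grad z)
  have d_h1ds: "dif (\<lambda>y. h1 (s y) *\<^sub>R ds y) z"
    by (intro differentiable_scaleR D_h_s d_ds z)
  have d_advt: "dif (\<lambda>y. \<alpha> *\<^sub>R dvt y) z"
    by (intro differentiable_scaleR differentiable_const dif_dvt z)
  have d_dw: "dif dw z"
    unfolding dw_def[abs_def] by (intro differentiable_diff d_h1ds d_advt)
  have cov_ds: "cov (E i) ds z = (2 *\<^sub>R (hess_s_third z + hess_s_square z)) $ i" for i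
  proof -
    have "D (E i) ds z = 2 *\<^sub>R D (E i) (\<lambda>y. hess_v y *v grad_v y) z"
      unfolding ds_def[abs_def] by (rule D_linear[OF z bounded_linear_scaleR_right dif_hess_grad[OF z]])
    then have "cov (E i) ds z = 2 *\<^sub>R cov (E i) (\<lambda>y. hess_v y *v grad_v y) z"
      by (simp add: cov_def ds_def vm.scaleR_left scaleR_diff_right)
    then show ?thesis by (simp add: cov_hess_grad_row[OF z])
  qed
  have cov_dw: "cov (E i) dw z
     = h1 (s z) *\<^sub>R cov (E i) ds z + (h2 (s z) * ds z $ i) *\<^sub>R ds z - \<alpha> *\<^sub>R cov (E i) dvt z" for i
  proof -
    have "D (E i) dw z = D (E i) (\<lambda>y. h1 (s y) *\<^sub>R ds y) z - D (E i) (\<lambda>y. \<alpha> *\<^sub>R dvt y) z"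
      unfolding dw_def[abs_def] by (intro D_diff z d_h1ds d_advt)
    also have "D (E i) (\<lambda>y. h1 (s y) *\<^sub>R ds y) z = h1 (s z) *\<^sub>R D (E i) ds z + D (E i) (\<lambda>y. h1 (s y)) z *\<^sub>R ds z"
      by (rule D_bilinear[OF z bounded_bilinear_scaleR D_h_s(4)[OF z] d_ds])
    also have "D (E i) (\<lambda>y. h1 (s y)) z = h2 (s z) * ds z $ i"
      by (simp add: D_h_s[OF z] D_s_E[OF z] ds_def)
    also have "D (E i) (\<lambda>y. \<alpha> *\<^sub>R dvt y) z = \<alpha> *\<^sub>R D (E i) dvt z"
      by (rule D_linear[OF z bounded_linear_scaleR_right dif_dvt[OF z]])
    finally show ?thesis
      by (simp add: cov_def dw_def[of z] vm.diff_left vm.scaleR_left algebra_simps)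
  qed
  let ?P = "\<chi> i j. ds z $ i * ds z $ j"
  have hess_w: "hess g c (?w (snd z)) (pt z)
     = (2 * h1 (s z)) *\<^sub>R (hess_s_third z + hess_s_square z) + h2 (s z) *\<^sub>R ?P + (- \<alpha>) *\<^sub>R cov_hess (0,1) z"
  proof -
    have "hess g c (?w (snd z)) (pt z) $ i = cov (E i) dw z" for i
      by (rule hess_row[OF z dw DwE d_dw])
    then show ?thesis
      by (simp add: vec_eq_iff cov_dw cov_ds cov_hess_time[OF z, symmetric] algebra_simps)
  qed
  have pds: "pd c i (grad_sq g c (v (snd z))) (pt z) = ds z $ i" for i
  proof -
    have s': "(\<lambda>y. grad_sq g c (v (snd y)) (pt y)) = s" by (simp add: s_def[abs_def])
    show ?thesis
      using pd_eq_D[OF z, of "\<lambda>\<tau>. grad_sq g c (v \<tau>)" i] dif_s[OF z] D_s_E[OF z, of i]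
      by (simp add: s' ds_def)
  qed
  have P: "(\<Sum>i\<in>UNIV. \<Sum>j\<in>UNIV. a_eps g p \<epsilon> c (v (snd z)) (pt z) $ i $ j
          * pd c i (grad_sq g c (v (snd z))) (pt z) * pd c j (grad_sq g c (v (snd z))) (pt z)) = a_trace z ?P"
    unfolding a_eps_contract[symmetric] by (simp add: pds mult.assoc)
  have dtw: "dt T ?w (snd z) (pt z) = h1 (s z) * (2 * (grad_v z \<bullet> dvt z)) - \<alpha> * D (0,1) vt z"
    using dt_eq_D[OF z, of ?w] dw[OF z] Dw[OF z] by (simp add: D_s[OF z] cov_dv_time)
  have "grad g c (?w (snd z)) (pt z) = inv_metric z *v dw z"
    unfolding inv_metric_def by (rule grad_eq) (use pd_eq_D[OF z, of ?w] dw[OF z] DwE[OF z] in simp)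
  then have gw: "g_inner g c (pt z) (grad g c (?w (snd z)) (pt z)) (A z) = dw z \<bullet> A z"
    by (simp add: g_inner_eq metric_def[symmetric] inv_metric_inner[OF z, symmetric] matrix_vector_mul_assoc inv_metric_metric[OF z])
  have "dw z \<bullet> A z = 2 * h1 (s z) * ((hess_v z *v grad_v z) \<bullet> A z) - \<alpha> * (dvt z \<bullet> A z)"
    by (simp add: dw_def ds_def inner_diff_left)
  then show ?thesis
    unfolding L_eps_eq hess_w dtw P gw a_trace_add a_trace_scaleR a_trace_hess_s_third[OF z] a_trace_hess_s_square[OF z]
      vt_evolution[OF z] vt_along_gradient[OF z]
    by (simp add: algebra_simps)
qed

end

theorem lemma5p1:
  fixes M :: "'a topology"
    and \<A> :: "('a, 'n::finite) chart set"
    and g :: "('a, 'n) metric"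
    and p \<epsilon> T \<alpha> t :: real
    and h :: "real \<Rightarrow> real"
    and v :: "real \<Rightarrow> 'a \<Rightarrow> real"
    and c :: "('a, 'n) chart"
    and x :: 'a
  assumes "riemannian_manifold M \<A> g"
    and "1 < p" and "0 < \<epsilon>" and "0 < T"
    and "smooth_on {0..} h"
    and "smooth_solution \<A> g p \<epsilon> h T v"
    and "c \<in> \<A>" and "x \<in> cdom c" and "t \<in> {0<..T}"
  defines "s \<equiv> grad_sq g c (v t)"
    and "w \<equiv> w_alpha g h T \<alpha> c v"
    and "h' \<equiv> deriv_within {0..} h"
    and "h'' \<equiv> deriv_within {0..} (deriv_within {0..} h)"
  shows "L_eps g p \<epsilon> c (v t) (w t) x - dt T w t x =
           2 * h' (s x) * (Q_eps g p \<epsilon> c (v t) x + Ric g c x (grad g c (v t) x) (grad g c (v t) x))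
           + h'' (s x) * (\<Sum>i\<in>UNIV. \<Sum>j\<in>UNIV. a_eps g p \<epsilon> c (v t) x $ i $ j * pd c i s x * pd c j s x)
           - 2 * g_inner g c x (grad g c (w t) x) (A_eps g p \<epsilon> h c (v t) x)"
proof -
  have man: "smooth_manifold M \<A>" and met: "riemannian_metric \<A> g"
    using assms(1) by (auto simp: riemannian_manifold_def)
  have hom: "homeomorphic_map (subtopology M (cdom c)) (top_of_set (cmap c ` cdom c)) (cmap c)"
    and opn: "open (cmap c ` cdom c)" and sub: "cdom c \<subseteq> topspace M"
    using man \<open>c \<in> \<A>\<close> by (auto simp: smooth_manifold_def)
  have inj: "inj_on (cmap c) (cdom c)"
    using homeomorphic_imp_injective_map[OF hom] sub by (simp add: Int_absorb1)
  interpret metric_chart c g T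
    by unfold_locales (use opn inj met assms(4,7) in \<open>auto simp: riemannian_metric_def\<close>)
  interpret heat_solution c g T p \<epsilon> h v
  proof
    show "smooth_on S (\<lambda>z. v (snd z) (cinv c (fst z)))"
      using assms(6,7) by (simp add: smooth_solution_def smooth_spacetime_def S_def case_prod_unfold)
    show "dt T v (snd z) (cinv c (fst z)) = L_eps g p \<epsilon> c (v (snd z)) (v (snd z)) (cinv c (fst z))
       + h (grad_sq g c (v (snd z)) (cinv c (fst z)))" if "z \<in> S" for z
      using assms(6,7) pt_in[OF that] that by (auto simp: smooth_solution_def S_def)
  qed (use assms in auto)
  have z: "(cmap c x, t) \<in> S" using assms(8,9) by (simp add: S_def)
  have px: "cinv c (cmap c x) = x" using pt_cmap[OF assms(8), of t] by simp
  show ?thesis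
    using evolution_of_w[OF z, of \<alpha>]
    by (simp add: px grad_v_def A_def assms(10-13) local.s_def)
qed

end
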